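(* Let $n,d\ge 1$, let $X, X_1,\dots,X_n$ be independent canonical $\mathbb{R}^d$-valued Gaussian random vectors, and let $g_1,\dots,g_n$ be independent standard real Gaussian random variables such that the family $\{g_1,\dots,g_n\}$ is independent of $\{X,X_1,\dots,X_n\}$. For $x=(x^1,\dots,x^n)\in\mathbb{R}^n$ put $$X_x=\sum_{i=1}^n x^iX_i,\qquad g_x=\sum_{i=1}^n x^i g_i .$$ Let $A$ be a nonempty subset of the closed Euclidean unit ball $B_2^n$ of $\mathbb{R}^n$, and for each $x\in A$ let $F_x:\mathbb{R}^d\to\mathbb{R}$ be a $1$-Lipschitz function. Then $$\mathbb{E}\,\sup_{x\in A}F_x(X_x)\;\le\;\mathbb{E}\,\sup_{x\in A}\bigl\{F_x(\|x\|_2X)+g_x\bigr\}.$$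
   Context: A canonical $\mathbb{R}^d$-valued Gaussian random vector is a centered Gaussian vector whose covariance matrix is the identity $\mathrm{Id}_d$. $\|x\|_2=(\sum_i (x^i)^2)^{1/2}$ is the Euclidean norm, and $1$-Lipschitz means Lipschitz with constant $1$ with respect to the Euclidean norm on $\mathbb{R}^d$. All random variables live on a common probability space. Expectations of suprema may take the value $+\infty$. *)

theory Defs
  imports "HOL-Probability.Probability"
begin

text \<open>As usual for Gaussian vectors, the one-dimensional marginals may be degenerate (constant).\<close>

definition real_gaussian :: "'w measure \<Rightarrow> ('w \<Rightarrow> real) \<Rightarrow> bool" where
  "real_gaussian M Y \<longleftrightarrow> Y \<in> borel_measurable M \<and>
     ((\<exists>c. AE w in M. Y w = c) \<or>
      (\<exists>\<mu> \<sigma>. \<sigma> > 0 \<and> distributed M lborel Y (normal_density \<mu> \<sigma>)))"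

definition gaussian_vector :: "'w measure \<Rightarrow> ('w \<Rightarrow> real ^ 'd) \<Rightarrow> bool" where
  "gaussian_vector M X \<longleftrightarrow> X \<in> borel_measurable M \<and>
     (\<forall>u. real_gaussian M (\<lambda>w. u \<bullet> X w))"

definition mean_vector :: "'w measure \<Rightarrow> ('w \<Rightarrow> real ^ 'd) \<Rightarrow> real ^ 'd" where
  "mean_vector M X = (\<chi> i. \<integral>w. X w $ i \<partial>M)"

definition covariance_matrix :: "'w measure \<Rightarrow> ('w \<Rightarrow> real ^ 'd) \<Rightarrow> real ^ 'd ^ 'd" where
  "covariance_matrix M X =
     (\<chi> i j. \<integral>w. (X w $ i - mean_vector M X $ i) * (X w $ j - mean_vector M X $ j) \<partial>M)"

definition canonical_gaussian :: "'w measure \<Rightarrow> ('w \<Rightarrow> real ^ 'd) \<Rightarrow> bool" where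
  "canonical_gaussian M X \<longleftrightarrow>
     gaussian_vector M X \<and> mean_vector M X = 0 \<and> covariance_matrix M X = mat 1"

text \<open>
  The integral of an extended-real function as integral of the positive part minus integral of the
  negative part; \<^const>\<open>e2ennreal\<close> truncates negative values to 0. The definition is meant
  for measurable functions with at least one of the two parts of finite integral
  (note that \<open>\<infinity> - \<infinity> = \<infinity>\<close> in \<^typ>\<open>ereal\<close>).
  A supremum of 1-Lipschitz functions of Gaussian vectors qualifies: it is a lower semicontinuous
  function of these vectors, and it is bounded below by an integrable member of the family.
\<close>

definition ext_expectation :: "'w measure \<Rightarrow> ('w \<Rightarrow> ereal) \<Rightarrow> ereal" where
  "ext_expectation M f =
     enn2ereal (\<integral>\<^sup>+ w. e2ennreal (f w) \<partial>M) - enn2ereal (\<integral>\<^sup>+ w. e2ennreal (- f w) \<partial>M)"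

end

theory Submission
  imports Defs
begin

text \<open>
  A 1-Lipschitz function satisfies \<open>F y = sup\<^sub>z (F z - \<parallel>y - z\<parallel>)\<close>, so the left-hand side is a supremum
  over pairs \<open>(x, z)\<close>, which by the Lindelof property and monotone convergence may be taken finite;
  the pairs \<open>j = (x\<^sub>j, z\<^sub>j)\<close> then carry the explicit functions \<open>F x\<^sub>j z\<^sub>j - \<parallel>y - z\<^sub>j\<parallel>\<close>.
  Replace the norm by \<open>sqrt (\<delta>\<^sup>2 + \<parallel>y - z\<^sub>j\<parallel>\<^sup>2)\<close>, which gives smooth \<open>f\<^sub>j\<close> with \<open>\<parallel>\<nabla>f\<^sub>j\<parallel> \<le> 1\<close>, and the maximum by
  \<open>ln (\<Sum>\<^sub>j exp (\<beta> s\<^sub>j)) / \<beta>\<close>, and interpolate with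
  \<open>s\<^sub>j = f\<^sub>j (sin \<theta> X\<^bsub>x\<^sub>j\<^esub> + cos \<theta> \<parallel>x\<^sub>j\<parallel> X) + cos \<theta> g\<^bsub>x\<^sub>j\<^esub>\<close> between \<open>\<theta> = 0\<close> and \<open>\<theta> = \<pi> / 2\<close>.
  The argument of \<open>f\<^sub>j\<close> is independent of its \<open>\<theta>\<close>-derivative, so Gaussian integration by parts
  never differentiates \<open>\<nabla>f\<^sub>j\<close>. With the softmax weights \<open>p\<^sub>j\<close>, the \<open>\<theta>\<close>-derivative of the expectation is
  \<open>-\<beta> sin \<theta> cos \<theta>\<close> times the expectation of
  \<open>\<Sum>\<^sub>i\<^sub>j p\<^sub>i p\<^sub>j ((x\<^sub>i \<bullet> x\<^sub>j - \<parallel>x\<^sub>i\<parallel> \<parallel>x\<^sub>j\<parallel>) (\<nabla>f\<^sub>i \<bullet> \<nabla>f\<^sub>j) + \<parallel>x\<^sub>i - x\<^sub>j\<parallel>\<^sup>2 / 2)\<close>.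
  As \<open>\<nabla>f\<^sub>i \<bullet> \<nabla>f\<^sub>j \<le> 1\<close>, each summand is at least \<open>p\<^sub>i p\<^sub>j (\<parallel>x\<^sub>i\<parallel> - \<parallel>x\<^sub>j\<parallel>)\<^sup>2 / 2 \<ge> 0\<close>, hence the expectation
  decreases in \<open>\<theta>\<close>. Only the law of the joint vector \<open>(X, (X\<^sub>i), (g\<^sub>i))\<close> matters, and it is identified as
  standard Gaussian through its characteristic function.
\<close>

subsection \<open>The standard Gaussian measure and integration by parts\<close>

text \<open>The mean value inequality bounds the difference quotients by \<open>g\<close>, so
  dominated convergence applies along every null sequence. The bound holds only within
  \<open>e\<close> of \<open>t0\<close>, hence the shift of the sequence by
  \<open>N\<close>.\<close>

lemma DERIV_integral_dominated:
  fixes f f' :: "real \<Rightarrow> 'a \<Rightarrow> real"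
  assumes e: "e > 0"
    and int: "\<And>t. integrable M (f t)"
    and meas: "f' t0 \<in> borel_measurable M"
    and g: "integrable M g"
    and deriv: "\<And>t x. x \<in> space M \<Longrightarrow> \<bar>t - t0\<bar> < e \<Longrightarrow> ((\<lambda>t. f t x) has_real_derivative f' t x) (at t)"
    and bound: "\<And>t x. x \<in> space M \<Longrightarrow> \<bar>t - t0\<bar> < e \<Longrightarrow> \<bar>f' t x\<bar> \<le> g x"
  shows "((\<lambda>t. \<integral>x. f t x \<partial>M) has_real_derivative (\<integral>x. f' t0 x \<partial>M)) (at t0)"
  unfolding DERIV_def tendsto_at_iff_sequentially
proof (intro allI impI)
  fix X :: "nat \<Rightarrow> real"
  assume X: "\<forall>i. X i \<in> UNIV - {0}" "X \<longlonglongrightarrow> 0"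
  then have X0: "X i \<noteq> 0" for i by auto
  from X(2) e obtain N where N: "\<And>n. n \<ge> N \<Longrightarrow> \<bar>X n\<bar> < e"
    by (metis (no_types, lifting) LIMSEQ_iff diff_0_right real_norm_def)
  define Y where "Y n = X (n + N)" for n
  have Y0: "Y n \<noteq> 0" and Ye: "\<bar>Y n\<bar> < e" for n
    using X0 N[of "n + N"] by (auto simp: Y_def)
  have Y: "Y \<longlonglongrightarrow> 0" unfolding Y_def using X(2) by (rule LIMSEQ_ignore_initial_segment)
  have "(\<lambda>n. \<integral>x. (f (t0 + Y n) x - f t0 x) / Y n \<partial>M) \<longlonglongrightarrow> (\<integral>x. f' t0 x \<partial>M)"
  proof (rule integral_dominated_convergence[where w = g])
    show "(\<lambda>x. (f (t0 + Y n) x - f t0 x) / Y n) \<in> borel_measurable M" for n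
      using int by (intro borel_measurable_divide borel_measurable_diff) auto
    show "AE x in M. (\<lambda>n. (f (t0 + Y n) x - f t0 x) / Y n) \<longlonglongrightarrow> f' t0 x"
    proof (rule AE_I2)
      fix x assume "x \<in> space M"
      then have "(\<lambda>h. (f (t0 + h) x - f t0 x) / h) \<midarrow>0\<rightarrow> f' t0 x"
        using deriv[of x t0] e unfolding DERIV_def by simp
      then show "(\<lambda>n. (f (t0 + Y n) x - f t0 x) / Y n) \<longlonglongrightarrow> f' t0 x"
        using Y Y0 unfolding tendsto_at_iff_sequentially by (auto simp: o_def)
    qed
    show "AE x in M. norm ((f (t0 + Y n) x - f t0 x) / Y n) \<le> g x" for n
    proof (rule AE_I2)
      fix x assume x: "x \<in> space M"
      have "norm (f (t0 + Y n) x - f t0 x) \<le> g x * norm (t0 + Y n - t0)"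
      proof (rule field_differentiable_bound[where S = "ball t0 e" and f' = "\<lambda>t. f' t x"])
        show "((\<lambda>t. f t x) has_real_derivative f' t x) (at t within ball t0 e)" if "t \<in> ball t0 e" for t
          using deriv[OF x, of t] that by (auto simp: dist_real_def intro: has_field_derivative_at_within)
        show "norm (f' t x) \<le> g x" if "t \<in> ball t0 e" for t
          using bound[OF x, of t] that by (auto simp: dist_real_def)
      qed (use e Ye[of n] in \<open>auto simp: dist_real_def\<close>)
      then show "norm ((f (t0 + Y n) x - f t0 x) / Y n) \<le> g x"
        using Y0[of n] by (simp add: field_simps)
    qed
  qed (use meas g in auto)
  then have "(\<lambda>n. ((\<integral>x. f (t0 + Y n) x \<partial>M) - (\<integral>x. f t0 x \<partial>M)) / Y n) \<longlonglongrightarrow> (\<integral>x. f' t0 x \<partial>M)"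
    using int by simp
  then show "((\<lambda>h. ((\<integral>x. f (t0 + h) x \<partial>M) - (\<integral>x. f t0 x \<partial>M)) / h) \<circ> X) \<longlonglongrightarrow> (\<integral>x. f' t0 x \<partial>M)"
    unfolding Y_def o_def by (rule LIMSEQ_offset)
qed

section \<open>The Gaussian density, translations, exponential moments and Stein's identity\<close>

definition gauss_density :: "'a::euclidean_space \<Rightarrow> real" where
  "gauss_density x = (\<Prod>b\<in>Basis. std_normal_density (x \<bullet> b))"

definition gauss_measure :: "'a::euclidean_space measure" where
  "gauss_measure = density lborel (\<lambda>x. ennreal (gauss_density x))"

lemma gauss_density_measurable [measurable]: "gauss_density \<in> borel_measurable borel"
  unfolding gauss_density_def[abs_def] by measurable

lemma gauss_density_nonneg [simp]: "gauss_density x \<ge> 0"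
  unfolding gauss_density_def by (simp add: prod_nonneg)

text \<open>The normalising constant is never evaluated; it is carried along as
  \<open>gauss_density 0\<close>.\<close>

lemma gauss_density_exp: "gauss_density x = gauss_density (0::'a) * exp (- (x \<bullet> x) / 2)"
  for x :: "'a::euclidean_space"
proof -
  have "(\<Prod>b\<in>Basis. exp (- (x \<bullet> b)\<^sup>2 / 2)) = exp (- (x \<bullet> x) / 2)"
    by (subst (2) euclidean_inner)
       (simp add: exp_sum[symmetric] sum_negf sum_divide_distrib[symmetric] power2_eq_square)
  then show ?thesis
    by (simp add: gauss_density_def normal_density_def prod.distrib prod_dividef power_divide)
qed

lemma sets_gauss_measure [simp, measurable_cong]: "sets gauss_measure = sets borel"
  by (simp add: gauss_measure_def)

lemma space_gauss_measure [simp]: "space gauss_measure = UNIV"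
  by (simp add: gauss_measure_def)

lemma nn_integral_gauss_density: "(\<integral>\<^sup>+x. ennreal (gauss_density (x::'a::euclidean_space)) \<partial>lborel) = 1"
proof -
  have "(\<integral>\<^sup>+x. ennreal (gauss_density (x::'a)) \<partial>lborel)
      = (\<integral>\<^sup>+x. (\<Prod>b\<in>Basis. ennreal (std_normal_density ((x::'a) \<bullet> b))) \<partial>lborel)"
    by (simp add: gauss_density_def prod_ennreal)
  also have "\<dots> = (\<Prod>b\<in>(Basis::'a set). (\<integral>\<^sup>+x. ennreal (std_normal_density x) \<partial>lborel))"
    by (subst nn_integral_lborel_prod) auto
  also have "(\<integral>\<^sup>+x. ennreal (std_normal_density x) \<partial>lborel) = 1"
    by (subst nn_integral_eq_integral) (auto simp: normal_density_nonneg)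
  finally show ?thesis by simp
qed

lemma prob_space_gauss_measure: "prob_space (gauss_measure :: 'a::euclidean_space measure)"
  by standard (simp add: gauss_measure_def emeasure_density nn_integral_gauss_density)

interpretation gauss: prob_space "gauss_measure :: 'a::euclidean_space measure"
  by (rule prob_space_gauss_measure)

lemma gauss_density_translate:
  "gauss_density (x - a) = exp (a \<bullet> x - (a \<bullet> a) / 2) * gauss_density x"
proof -
  have "- ((x - a) \<bullet> (x - a)) / 2 = (a \<bullet> x - (a \<bullet> a) / 2) + - (x \<bullet> x) / 2"
    by (simp add: inner_diff_left inner_diff_right inner_commute field_simps)
  then show ?thesis
    by (simp only: gauss_density_exp[of "x - a"] gauss_density_exp[of x] exp_add mult_ac)
qed

lemma distr_lborel_plus: "distr lborel borel (\<lambda>x. x + a) = (lborel :: 'a::euclidean_space measure)"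
  using lborel_distr_plus[of a] by (simp add: add.commute cong: distr_cong)

text \<open>The Cameron-Martin formula in finite dimension: Lebesgue measure is translation
  invariant, and the weight is the ratio of the shifted density to the original one.\<close>

lemma distr_gauss_translate:
  "distr gauss_measure borel (\<lambda>x. x + a)
   = density gauss_measure (\<lambda>x. ennreal (exp (a \<bullet> x - (a \<bullet> a) / 2)))"
  (is "?L = ?R")
proof (rule measure_eqI)
  fix A :: "'a set" assume "A \<in> sets (distr gauss_measure borel (\<lambda>x. x + a))"
  then have A [measurable]: "A \<in> sets borel" by simp
  have "emeasure ?L A = (\<integral>\<^sup>+x. indicator A x \<partial>?L)" by simp
  also have "\<dots> = (\<integral>\<^sup>+x. ennreal (gauss_density (x + a - a)) * indicator A (x + a) \<partial>lborel)"
    by (simp add: gauss_measure_def nn_integral_distr nn_integral_density del: nn_integral_indicator)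
  also have "\<dots> = (\<integral>\<^sup>+x. ennreal (gauss_density (x - a)) * indicator A x \<partial>distr lborel borel (\<lambda>x. x + a))"
    by (subst nn_integral_distr) auto
  also have "\<dots> = (\<integral>\<^sup>+x. ennreal (gauss_density x) * (ennreal (exp (a \<bullet> x - (a \<bullet> a) / 2)) * indicator A x) \<partial>lborel)"
    by (simp add: distr_lborel_plus gauss_density_translate ennreal_mult ac_simps)
  also have "\<dots> = emeasure ?R A"
    by (simp add: emeasure_density, simp add: gauss_measure_def nn_integral_density)
  finally show "emeasure ?L A = emeasure ?R A" .
qed simp

lemma integral_gauss_translate:
  fixes h :: "'a::euclidean_space \<Rightarrow> real"
  assumes [measurable]: "h \<in> borel_measurable borel"
  shows "(\<integral>x. h (x + a) \<partial>gauss_measure) = (\<integral>x. h x * exp (a \<bullet> x - (a \<bullet> a) / 2) \<partial>gauss_measure)"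
proof -
  have "(\<integral>x. h (x + a) \<partial>gauss_measure) = (\<integral>x. h x \<partial>distr gauss_measure borel (\<lambda>x. x + a))"
    by (simp add: integral_distr)
  then show ?thesis
    by (simp add: distr_gauss_translate integral_density mult.commute)
qed

text \<open>Up to a constant factor the exponential is the density of a translated Gaussian measure,
  which has total mass 1. Exponential moments thus come without any computation.\<close>

lemma integrable_gauss_exp: "integrable gauss_measure (\<lambda>x::'a::euclidean_space. exp (a \<bullet> x))"
proof -
  have "prob_space (distr gauss_measure borel (\<lambda>x. x + a))"
    by (rule gauss.prob_space_distr) simp
  then have "integrable (distr gauss_measure borel (\<lambda>x. x + a)) (\<lambda>_. 1::real)"
    by (metis finite_measure.integrable_const prob_space.finite_measure)
  then have "integrable gauss_measure (\<lambda>x. exp (a \<bullet> x - (a \<bullet> a) / 2))"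
    unfolding distr_gauss_translate by (subst (asm) integrable_real_density) auto
  then have "integrable gauss_measure (\<lambda>x. exp (a \<bullet> a / 2) * exp (a \<bullet> x - (a \<bullet> a) / 2))"
    by (rule integrable_mult_right)
  then show ?thesis by (simp add: exp_diff)
qed

lemma integrable_gauss_exp_abs: "integrable gauss_measure (\<lambda>x::'a::euclidean_space. exp \<bar>a \<bullet> x\<bar>)"
proof (rule Bochner_Integration.integrable_bound)
  show "integrable gauss_measure (\<lambda>x::'a. exp (a \<bullet> x) + exp ((- a) \<bullet> x))"
    by (intro Bochner_Integration.integrable_add integrable_gauss_exp)
  show "AE x in gauss_measure. norm (exp \<bar>a \<bullet> x\<bar>) \<le> norm (exp (a \<bullet> x) + exp ((- a) \<bullet> x))"
  proof (rule AE_I2)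
    fix x :: 'a
    have "exp (a \<bullet> x) > 0" "exp (- (a \<bullet> x)) > 0" by auto
    then show "norm (exp \<bar>a \<bullet> x\<bar>) \<le> norm (exp (a \<bullet> x) + exp ((- a) \<bullet> x))"
      by (cases "a \<bullet> x \<ge> 0") (simp_all add: abs_of_pos[OF add_pos_pos])
  qed
qed simp

lemma integrable_gauss_inner: "integrable gauss_measure (\<lambda>x::'a::euclidean_space. a \<bullet> x)"
proof (rule Bochner_Integration.integrable_bound[OF integrable_gauss_exp_abs[of a]])
  show "AE x in gauss_measure. norm (a \<bullet> x) \<le> norm (exp \<bar>a \<bullet> x\<bar>)"
  proof (rule AE_I2)
    fix x :: 'a
    show "norm (a \<bullet> x) \<le> norm (exp \<bar>a \<bullet> x\<bar>)"
      using exp_ge_add_one_self[of "\<bar>a \<bullet> x\<bar>"] unfolding real_norm_def abs_exp_cancel by linarith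
  qed
qed simp

lemma integrable_gauss_norm: "integrable gauss_measure (\<lambda>x::'a::euclidean_space. norm x)"
proof (rule Bochner_Integration.integrable_bound)
  show "integrable gauss_measure (\<lambda>x::'a. \<Sum>b\<in>Basis. \<bar>b \<bullet> x\<bar>)"
    by (intro Bochner_Integration.integrable_sum integrable_abs integrable_gauss_inner)
  show "AE x in gauss_measure. norm (norm x) \<le> norm (\<Sum>b\<in>Basis. \<bar>b \<bullet> x\<bar>)"
    using norm_le_l1 by (intro AE_I2) (auto simp: inner_commute sum_nonneg)
qed simp

text \<open>Stein's identity. Both sides of \<open>integral_gauss_translate\<close> for the shift
  \<open>t *\<^sub>R a\<close> are differentiated at \<open>t = 0\<close>: on the left the
  derivative falls on \<open>h\<close>, on the right on the exponential weight. Only the derivative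
  of \<open>h\<close> along \<open>a\<close> enters.\<close>

lemma gauss_integration_by_parts:
  fixes h d :: "'a::euclidean_space \<Rightarrow> real"
  assumes [measurable]: "h \<in> borel_measurable borel" "d \<in> borel_measurable borel"
    and hB: "\<And>x. \<bar>h x\<bar> \<le> B" and dC: "\<And>x. \<bar>d x\<bar> \<le> C"
    and deriv: "\<And>x t. ((\<lambda>t. h (x + t *\<^sub>R a)) has_real_derivative d (x + t *\<^sub>R a)) (at t)"
  shows "(\<integral>x. h x * (a \<bullet> x) \<partial>gauss_measure) = (\<integral>x. d x \<partial>gauss_measure)"
proof -
  define c where "c = a \<bullet> a"
  have c: "c \<ge> 0" unfolding c_def by simp
  let ?e = "\<lambda>t x. exp (t * (a \<bullet> x) - t^2 * c / 2)"
  have B: "B \<ge> 0" using hB[of 0] by linarith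
  have int_e: "integrable gauss_measure (\<lambda>x. h x * ?e t x)" for t
  proof (rule Bochner_Integration.integrable_bound)
    show "integrable gauss_measure (\<lambda>x. B * exp ((t *\<^sub>R a) \<bullet> x))"
      by (intro integrable_mult_right integrable_gauss_exp)
    show "AE x in gauss_measure. norm (h x * ?e t x) \<le> norm (B * exp ((t *\<^sub>R a) \<bullet> x))"
      using hB B c by (intro AE_I2) (auto simp: abs_mult intro!: mult_mono)
  qed simp
  have 1: "((\<lambda>t. \<integral>x. h (x + t *\<^sub>R a) \<partial>gauss_measure) has_real_derivative
        (\<integral>x. d (x + 0 *\<^sub>R a) \<partial>gauss_measure)) (at 0)"
    by (rule DERIV_integral_dominated[where e = 1 and g = "\<lambda>_. C"])
       (use deriv dC hB in \<open>auto intro!: gauss.integrable_const_bound[where B = B]\<close>)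
  have 2: "((\<lambda>t. \<integral>x. h x * ?e t x \<partial>gauss_measure) has_real_derivative
        (\<integral>x. h x * ((a \<bullet> x - 0 * c) * ?e 0 x) \<partial>gauss_measure)) (at 0)"
  proof (rule DERIV_integral_dominated[where e = 1 and
        f' = "\<lambda>t x. h x * ((a \<bullet> x - t * c) * ?e t x)" and
        g = "\<lambda>x. B * ((1 + c) * exp \<bar>(2 *\<^sub>R a) \<bullet> x\<bar>)"])
    show "integrable gauss_measure (\<lambda>x. B * ((1 + c) * exp \<bar>(2 *\<^sub>R a) \<bullet> x\<bar>))"
      by (intro integrable_mult_right integrable_gauss_exp_abs)
    show "((\<lambda>t. h x * ?e t x) has_real_derivative h x * ((a \<bullet> x - t * c) * ?e t x)) (at t)" for t x
      by (auto intro!: derivative_eq_intros simp: algebra_simps)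
    \<comment> \<open>For \<open>\<bar>t\<bar> < 1\<close> the linear factor costs one
      \<open>exp \<bar>a \<bullet> x\<bar>\<close> and the exponential weight another one, whence
      the factor 2 in the dominating function.\<close>
    fix t :: real and x :: 'a assume t: "\<bar>t - 0\<bar> < 1"
    let ?s = "\<bar>a \<bullet> x\<bar>"
    have "\<bar>a \<bullet> x - t * c\<bar> \<le> ?s + c"
      using t c mult_right_mono[of "\<bar>t\<bar>" 1 c] abs_triangle_ineq4[of "a \<bullet> x" "t * c"]
      by (simp add: abs_mult)
    also have "\<dots> \<le> (1 + c) * exp ?s"
    proof -
      have "?s + 1 \<le> exp ?s" "1 \<le> exp ?s" using exp_ge_add_one_self[of ?s] by linarith+
      moreover have "c * 1 \<le> c * exp ?s" using c by (intro mult_left_mono) auto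
      ultimately show ?thesis unfolding distrib_right by linarith
    qed
    finally have p1: "\<bar>a \<bullet> x - t * c\<bar> \<le> (1 + c) * exp ?s" .
    have "t * (a \<bullet> x) \<le> ?s"
      using t mult_right_mono[of "\<bar>t\<bar>" 1 ?s] abs_le_D1[of "t * (a \<bullet> x)" "\<bar>t\<bar> * ?s"]
      by (simp add: abs_mult)
    then have p2: "?e t x \<le> exp ?s" using mult_nonneg_nonneg[OF zero_le_power2[of t] c] by simp
    have "\<bar>a \<bullet> x - t * c\<bar> * ?e t x \<le> ((1 + c) * exp ?s) * exp ?s"
      using p1 p2 c by (intro mult_mono) auto
    also have "\<dots> = (1 + c) * exp \<bar>(2 *\<^sub>R a) \<bullet> x\<bar>"
      by (simp add: mult.assoc exp_add[symmetric] abs_mult)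
    finally have "\<bar>h x\<bar> * (\<bar>a \<bullet> x - t * c\<bar> * ?e t x) \<le> B * ((1 + c) * exp \<bar>(2 *\<^sub>R a) \<bullet> x\<bar>)"
      by (rule mult_mono[OF hB _ B]) simp
    then show "\<bar>h x * ((a \<bullet> x - t * c) * ?e t x)\<bar> \<le> B * ((1 + c) * exp \<bar>(2 *\<^sub>R a) \<bullet> x\<bar>)"
      by (simp add: abs_mult)
  qed (use int_e in auto)
  have e: "(t *\<^sub>R a) \<bullet> x - ((t *\<^sub>R a) \<bullet> (t *\<^sub>R a)) / 2 = t * (a \<bullet> x) - t^2 * c / 2" for t x
    by (simp add: c_def power2_eq_square)
  have "(\<integral>x. h (x + t *\<^sub>R a) \<partial>gauss_measure) = (\<integral>x. h x * ?e t x \<partial>gauss_measure)" for t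
    using integral_gauss_translate[OF assms(1), of "t *\<^sub>R a"] unfolding e .
  then have eq: "(\<lambda>t. \<integral>x. h (x + t *\<^sub>R a) \<partial>gauss_measure) = (\<lambda>t. \<integral>x. h x * ?e t x \<partial>gauss_measure)"
    by (rule ext)
  have "(\<integral>x. d (x + 0 *\<^sub>R a) \<partial>gauss_measure) = (\<integral>x. h x * ((a \<bullet> x - 0 * c) * ?e 0 x) \<partial>gauss_measure)"
    by (rule DERIV_unique[OF 1[unfolded eq] 2])
  then show ?thesis by simp
qed

text \<open>Stein's identity applied to the derivative of \<open>\<phi>\<close> yields the
  differential equation \<open>\<phi>' = - t k \<phi>\<close>. The phase \<open>c\<close> encodes
  the real and the imaginary part of the characteristic function together and keeps all integrals
  real.\<close>

lemma gauss_cos: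
  "(\<integral>u. cos (y \<bullet> u + c) \<partial>gauss_measure) = cos c * exp (- (y \<bullet> y) / 2)" for y :: "'a::euclidean_space"
proof -
  define k where "k = y \<bullet> y"
  define \<phi> where "\<phi> t = (\<integral>u. cos (t * (y \<bullet> u) + c) \<partial>gauss_measure)" for t
  have "(\<phi> has_real_derivative (- (t * k * \<phi> t))) (at t)" for t
  proof -
    have "(\<phi> has_real_derivative (\<integral>u. - sin (t * (y \<bullet> u) + c) * (y \<bullet> u) \<partial>gauss_measure)) (at t)"
      unfolding \<phi>_def
    proof (rule DERIV_integral_dominated[where e = 1 and g = "\<lambda>u. \<bar>y \<bullet> u\<bar>"])
      show "integrable gauss_measure (\<lambda>u. \<bar>y \<bullet> u\<bar>)"
        by (intro integrable_abs integrable_gauss_inner)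
      show "((\<lambda>t. cos (t * (y \<bullet> u) + c)) has_real_derivative - sin (t * (y \<bullet> u) + c) * (y \<bullet> u)) (at t)" for t u
        by (auto intro!: derivative_eq_intros)
      show "\<bar>- sin (t * (y \<bullet> u) + c) * (y \<bullet> u)\<bar> \<le> \<bar>y \<bullet> u\<bar>" for t u
        by (auto simp: abs_mult intro: mult_left_le_one_le)
    qed (auto intro!: gauss.integrable_const_bound[where B = 1])
    also have "(\<integral>u. - sin (t * (y \<bullet> u) + c) * (y \<bullet> u) \<partial>gauss_measure)
        = (\<integral>u. - (t * k) * cos (t * (y \<bullet> u) + c) \<partial>gauss_measure)"
    proof (rule gauss_integration_by_parts[where B = 1 and C = "\<bar>t * k\<bar>"])
      show "((\<lambda>s. - sin (t * (y \<bullet> (x + s *\<^sub>R y)) + c)) has_real_derivative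
           - (t * k) * cos (t * (y \<bullet> (x + s *\<^sub>R y)) + c)) (at s)" for x s
        by (auto intro!: derivative_eq_intros simp: inner_add_right k_def)
      show "\<bar>- (t * k) * cos (t * (y \<bullet> x) + c)\<bar> \<le> \<bar>t * k\<bar>" for x
        by (auto simp: abs_mult intro!: mult_right_le_one_le)
    qed auto
    also have "\<dots> = - (t * k * \<phi> t)" by (simp add: \<phi>_def)
    finally show ?thesis .
  qed
  \<comment> \<open>The equation is solved with an integrating factor: the product has derivative
    zero and is compared at 0 and 1.\<close>
  then have "((\<lambda>t. \<phi> t * exp (t^2 * k / 2)) has_real_derivative 0) (at t)" for t
    by (auto intro!: derivative_eq_intros simp: algebra_simps)
  then have "\<phi> 1 * exp (1^2 * k / 2) = \<phi> 0 * exp (0^2 * k / 2)"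
    by (intro DERIV_isconst_all) auto
  moreover have "\<phi> 0 = cos c" by (simp add: \<phi>_def gauss.prob_space[simplified])
  ultimately show ?thesis by (simp add: \<phi>_def k_def exp_minus field_simps)
qed

subsection \<open>Uniqueness of characteristic functions\<close>

lemma gauss_density_cos:
  "gauss_density x = gauss_density (0::'a) * (\<integral>u. cos (x \<bullet> u) \<partial>gauss_measure)"
  for x :: "'a::euclidean_space"
  using gauss_cos[of x 0] by (simp add: gauss_density_exp[of x])

text \<open>
  The Gaussian density is its own Fourier transform, so the density of the convolution of \<open>P\<close>
  with a scaled Gaussian only depends on the characteristic function of \<open>P\<close>.
\<close>

lemma nn_integral_gauss_smoothing:
  fixes P :: "'a::euclidean_space measure"
  assumes P: "prob_space P" and [measurable_cong]: "sets P = sets borel"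
    and [measurable]: "f \<in> borel_measurable borel" and s: "s > 0"
  shows "(\<integral>\<^sup>+x. \<integral>\<^sup>+z. f (x + s *\<^sub>R z) \<partial>gauss_measure \<partial>P)
    = (\<integral>\<^sup>+y. f y * ennreal ((1 / s) ^ DIM('a) * gauss_density (0::'a) *
         (\<integral>u. (\<integral>x. cos ((- u /\<^sub>R s) \<bullet> x + (y \<bullet> u) / s) \<partial>P) \<partial>gauss_measure)) \<partial>lborel)"
proof -
  interpret P: prob_space P by fact
  interpret PG: pair_prob_space P "gauss_measure :: 'a measure" ..
  interpret PL: pair_sigma_finite P "lborel :: 'a measure" ..
  define q where "q y x = (1 / s) ^ DIM('a) * gauss_density ((y - x) /\<^sub>R s)" for y x :: 'a
  have q0: "q y x \<ge> 0" for y x using s by (simp add: q_def)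
  have [measurable]: "(\<lambda>p. q (snd p) (fst p)) \<in> borel_measurable (P \<Otimes>\<^sub>M lborel)"
    "q y \<in> borel_measurable borel" "(\<lambda>y. q y x) \<in> borel_measurable borel" for x y
    unfolding q_def by measurable
  have "(\<integral>\<^sup>+z. f (x + s *\<^sub>R z) \<partial>gauss_measure) = (\<integral>\<^sup>+y. f y * ennreal (q y x) \<partial>lborel)" for x
  proof -
    have "(\<integral>\<^sup>+z. f (x + s *\<^sub>R z) \<partial>gauss_measure)
        = (\<integral>\<^sup>+z. ennreal (gauss_density z) * f (x + s *\<^sub>R z) \<partial>lborel)"
      by (simp add: gauss_measure_def nn_integral_density)
    \<comment> \<open>Substitution \<open>z = (y - x) / s\<close>; its Jacobian is the factor
      \<open>(1 / s) ^ DIM('a)\<close> in \<open>q\<close>.\<close>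
    also have "lborel = density (distr lborel borel (\<lambda>y. - x /\<^sub>R s + (1 / s) *\<^sub>R y))
        (\<lambda>_. ennreal (\<bar>1 / s\<bar> ^ DIM('a)))"
      by (rule lborel_affine) (use s in auto)
    also have "(\<integral>\<^sup>+z. ennreal (gauss_density z) * f (x + s *\<^sub>R z) \<partial>\<dots>)
       = (\<integral>\<^sup>+y. ennreal (\<bar>1 / s\<bar> ^ DIM('a)) *
          (ennreal (gauss_density (- x /\<^sub>R s + (1 / s) *\<^sub>R y)) * f (x + s *\<^sub>R (- x /\<^sub>R s + (1 / s) *\<^sub>R y))) \<partial>lborel)"
      by (simp add: nn_integral_density nn_integral_distr)
    also have "\<dots> = (\<integral>\<^sup>+y. f y * ennreal (q y x) \<partial>lborel)"
      using s by (intro nn_integral_cong)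
        (auto simp: q_def algebra_simps ennreal_mult inverse_eq_divide)
    finally show ?thesis .
  qed
  then have "(\<integral>\<^sup>+x. \<integral>\<^sup>+z. f (x + s *\<^sub>R z) \<partial>gauss_measure \<partial>P)
      = (\<integral>\<^sup>+x. \<integral>\<^sup>+y. f y * ennreal (q y x) \<partial>lborel \<partial>P)" by simp
  also have "\<dots> = (\<integral>\<^sup>+y. \<integral>\<^sup>+x. f y * ennreal (q y x) \<partial>P \<partial>lborel)"
    by (subst PL.Fubini') auto
  also have "\<dots> = (\<integral>\<^sup>+y. f y * (\<integral>\<^sup>+x. ennreal (q y x) \<partial>P) \<partial>lborel)"
    by (subst nn_integral_cmult) auto
  also have "(\<lambda>y. \<integral>\<^sup>+x. ennreal (q y x) \<partial>P) = (\<lambda>y. ennreal ((1 / s) ^ DIM('a) * gauss_density (0::'a) *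
         (\<integral>u. (\<integral>x. cos ((- u /\<^sub>R s) \<bullet> x + (y \<bullet> u) / s) \<partial>P) \<partial>gauss_measure)))"
  proof (rule ext)
    fix y
    define c where "c = (1 / s) ^ DIM('a) * gauss_density (0::'a)"
    have qc: "q y x = c * (\<integral>u. cos ((- u /\<^sub>R s) \<bullet> x + (y \<bullet> u) / s) \<partial>gauss_measure)" for x
      unfolding q_def c_def
      by (subst gauss_density_cos)
         (simp add: inner_diff_left inner_commute divide_inverse algebra_simps)
    have le: "\<bar>\<integral>u. cos ((- u /\<^sub>R s) \<bullet> x + (y \<bullet> u) / s) \<partial>gauss_measure\<bar> \<le> 1" for x
    proof -
      have "norm (\<integral>u. cos ((- u /\<^sub>R s) \<bullet> x + (y \<bullet> u) / s) \<partial>gauss_measure)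
        \<le> (\<integral>u. norm (cos ((- u /\<^sub>R s) \<bullet> x + (y \<bullet> u) / s)) \<partial>gauss_measure)"
        by (rule integral_norm_bound)
      also have "\<dots> \<le> 1" by (rule gauss.integral_le_const)
        (auto intro!: gauss.integrable_const_bound[where B = 1])
      finally show ?thesis by simp
    qed
    have "(\<integral>\<^sup>+x. ennreal (q y x) \<partial>P) = ennreal (\<integral>x. q y x \<partial>P)"
    proof (rule nn_integral_eq_integral)
      show "integrable P (q y)"
      proof (rule P.integrable_const_bound[where B = "\<bar>c\<bar>"])
        show "AE x in P. norm (q y x) \<le> \<bar>c\<bar>"
          using le by (intro AE_I2) (auto simp: qc abs_mult intro!: mult_right_le_one_le)
      qed simp
    qed (use q0 in auto)
    also have "(\<integral>x. q y x \<partial>P) = c * (\<integral>x. (\<integral>u. cos ((- u /\<^sub>R s) \<bullet> x + (y \<bullet> u) / s) \<partial>gauss_measure) \<partial>P)"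
      by (simp add: qc)
    also have "(\<integral>x. (\<integral>u. cos ((- u /\<^sub>R s) \<bullet> x + (y \<bullet> u) / s) \<partial>gauss_measure) \<partial>P)
        = (\<integral>u. (\<integral>x. cos ((- u /\<^sub>R s) \<bullet> x + (y \<bullet> u) / s) \<partial>P) \<partial>gauss_measure)"
      by (rule PG.Fubini_integral[symmetric]) (auto intro!: PG.P.integrable_const_bound[where B = 1])
    finally show "(\<integral>\<^sup>+x. ennreal (q y x) \<partial>P) = ennreal ((1 / s) ^ DIM('a) * gauss_density (0::'a) *
         (\<integral>u. (\<integral>x. cos ((- u /\<^sub>R s) \<bullet> x + (y \<bullet> u) / s) \<partial>P) \<partial>gauss_measure))"
      by (simp only: c_def)
  qed
  finally show ?thesis .
qed

text \<open>Dominated convergence is used twice with bound 1: first in \<open>z\<close>, by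
  continuity of \<open>f\<close> at \<open>x\<close>, then in \<open>x\<close>.\<close>

lemma nn_integral_gauss_smoothing_tendsto:
  fixes P :: "'a::euclidean_space measure" and f :: "'a \<Rightarrow> real"
  assumes P: "prob_space P" and [measurable_cong]: "sets P = sets borel"
    and f: "continuous_on UNIV f" and f0: "\<And>x. 0 \<le> f x" and f1: "\<And>x. f x \<le> 1"
  shows "(\<lambda>n. \<integral>\<^sup>+x. \<integral>\<^sup>+z. ennreal (f (x + (1 / Suc n) *\<^sub>R z)) \<partial>gauss_measure \<partial>P)
    \<longlonglongrightarrow> (\<integral>\<^sup>+x. ennreal (f x) \<partial>P)"
proof -
  interpret P: prob_space P by fact
  have [measurable]: "f \<in> borel_measurable borel"
    using f by (rule borel_measurable_continuous_onI)
  have 1: "(\<lambda>n. \<integral>\<^sup>+z. ennreal (f (x + (1 / Suc n) *\<^sub>R z)) \<partial>gauss_measure)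
      \<longlonglongrightarrow> (\<integral>\<^sup>+z. ennreal (f x) \<partial>(gauss_measure :: 'a measure))" for x
  proof (rule nn_integral_dominated_convergence[where w = "\<lambda>_. 1"])
    show "AE z in gauss_measure. (\<lambda>n. ennreal (f (x + (1 / Suc n) *\<^sub>R z))) \<longlonglongrightarrow> ennreal (f x)"
    proof (rule AE_I2)
      fix z
      have "(\<lambda>n. x + (1 / Suc n) *\<^sub>R z) \<longlonglongrightarrow> x + 0 *\<^sub>R z"
        by (intro tendsto_intros lim_1_over_n LIMSEQ_Suc)
      moreover have "isCont f x" using f by (simp add: continuous_on_eq_continuous_at)
      ultimately show "(\<lambda>n. ennreal (f (x + (1 / Suc n) *\<^sub>R z))) \<longlonglongrightarrow> ennreal (f x)"
        by (intro tendsto_ennrealI isCont_tendsto_compose[where g = f]) auto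
    qed
  qed (use f0 f1 gauss.emeasure_space_1[where 'a = 'a] in auto)
  show ?thesis
  proof (rule nn_integral_dominated_convergence[where w = "\<lambda>_. 1"])
    show "AE x in P. (\<lambda>n. \<integral>\<^sup>+z. ennreal (f (x + (1 / Suc n) *\<^sub>R z)) \<partial>gauss_measure) \<longlonglongrightarrow> ennreal (f x)"
      using 1 gauss.emeasure_space_1[where 'a = 'a] by simp
    show "AE x in P. (\<integral>\<^sup>+z. ennreal (f (x + (1 / Suc n) *\<^sub>R z)) \<partial>gauss_measure) \<le> 1" for n
      by (intro AE_I2 gauss.nn_integral_le_const) (use f1 in auto)
  qed (use P.emeasure_space_1 in auto)
qed

text \<open>At every positive scale the smoothed integrals agree, as they depend only on integrals
  of cosines. Letting the scale tend to 0 gives equality for continuous functions into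
  \<open>[0, 1]\<close>; these approximate indicators of closed sets, which form an
  intersection-stable generator.\<close>

lemma measure_eqI_cos:
  fixes P Q :: "'a::euclidean_space measure"
  assumes P: "prob_space P" "sets P = sets borel" and Q: "prob_space Q" "sets Q = sets borel"
    and eq: "\<And>u c. (\<integral>x. cos (u \<bullet> x + c) \<partial>P) = (\<integral>x. cos (u \<bullet> x + c) \<partial>Q)"
  shows "P = Q"
proof -
  interpret P: prob_space P by fact
  interpret Q: prob_space Q by fact
  have f: "(\<integral>\<^sup>+x. ennreal (f x) \<partial>P) = (\<integral>\<^sup>+x. ennreal (f x) \<partial>Q)"
    if c: "continuous_on UNIV f" and f01: "\<And>x. 0 \<le> f x" "\<And>x. f x \<le> 1" for f :: "'a \<Rightarrow> real"
  proof (rule LIMSEQ_unique)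
    have [measurable]: "f \<in> borel_measurable borel"
      using c by (rule borel_measurable_continuous_onI)
    have "(\<integral>\<^sup>+x. \<integral>\<^sup>+z. ennreal (f (x + (1 / Suc n) *\<^sub>R z)) \<partial>gauss_measure \<partial>P)
        = (\<integral>\<^sup>+x. \<integral>\<^sup>+z. ennreal (f (x + (1 / Suc n) *\<^sub>R z)) \<partial>gauss_measure \<partial>Q)" for n
      using nn_integral_gauss_smoothing[OF P, of "\<lambda>x. ennreal (f x)" "1 / Suc n"]
        nn_integral_gauss_smoothing[OF Q, of "\<lambda>x. ennreal (f x)" "1 / Suc n"]
      unfolding eq by simp
    then show "(\<lambda>n. \<integral>\<^sup>+x. \<integral>\<^sup>+z. ennreal (f (x + (1 / Suc n) *\<^sub>R z)) \<partial>gauss_measure \<partial>P)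
      \<longlonglongrightarrow> (\<integral>\<^sup>+x. ennreal (f x) \<partial>Q)"
      using nn_integral_gauss_smoothing_tendsto[OF Q c f01] by simp
    show "(\<lambda>n. \<integral>\<^sup>+x. \<integral>\<^sup>+z. ennreal (f (x + (1 / Suc n) *\<^sub>R z)) \<partial>gauss_measure \<partial>P)
      \<longlonglongrightarrow> (\<integral>\<^sup>+x. ennreal (f x) \<partial>P)"
      by (rule nn_integral_gauss_smoothing_tendsto[OF P c f01])
  qed
  have closed_eq: "emeasure P C = emeasure Q C" if C: "closed C" for C :: "'a set"
  \<comment> \<open>The empty set is separated because \<open>infdist x {} = 0\<close> would make
    every \<open>h n\<close> constantly 1 instead of approximating the indicator.\<close>
  proof (cases "C = {}")
    case False
    define h where "h n x = max 0 (1 - real n * infdist x C)" for n and x :: 'a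
    have h_cont: "continuous_on UNIV (h n)" for n
      unfolding h_def by (intro continuous_intros)
    then have [measurable]: "h n \<in> borel_measurable borel" for n
      by (rule borel_measurable_continuous_onI)
    have h01: "0 \<le> h n x" "h n x \<le> 1" for n x
      by (auto simp: h_def infdist_nonneg)
    have lim: "(\<lambda>n. ennreal (h n x)) \<longlonglongrightarrow> indicator C x" for x
    proof (cases "x \<in> C")
      case True
      then show ?thesis by (simp add: h_def)
    next
      case x: False
      then have "infdist x C > 0"
        using C False by (metis in_closed_iff_infdist_zero infdist_nonneg less_le)
      then obtain N where N: "1 < real N * infdist x C" using reals_Archimedean3 by blast
      have "h n x = 0" if "n \<ge> N" for n
        using that N mult_right_mono[of "real N" "real n" "infdist x C"] infdist_nonneg[of x C]
        by (auto simp: h_def max_def)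
      then have "eventually (\<lambda>n. ennreal (h n x) = 0) sequentially"
        unfolding eventually_sequentially by (metis ennreal_0)
      then show ?thesis using x by (simp add: tendsto_eventually)
    qed
    have to_C: "(\<lambda>n. \<integral>\<^sup>+x. ennreal (h n x) \<partial>R) \<longlonglongrightarrow> emeasure R C"
      if R: "prob_space R" and [measurable_cong]: "sets R = sets borel" for R :: "'a measure"
    proof -
      interpret R: prob_space R by fact
      have [measurable]: "C \<in> sets borel" using C by simp
      have "(\<lambda>n. \<integral>\<^sup>+x. ennreal (h n x) \<partial>R) \<longlonglongrightarrow> (\<integral>\<^sup>+x. indicator C x \<partial>R)"
        by (rule nn_integral_dominated_convergence[where w = "\<lambda>_. 1"])
           (use lim h01 C R.emeasure_space_1 in auto)
      then show ?thesis using C that by simp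
    qed
    show ?thesis
      by (rule LIMSEQ_unique[OF to_C[OF P]]) (use to_C[OF Q] f[OF h_cont h01] in simp)
  qed simp
  show ?thesis
  proof (rule measure_eqI_generator_eq[where E = "{C. closed C}" and \<Omega> = UNIV and A = "\<lambda>_. UNIV"])
    show "Int_stable {C :: 'a set. closed C}" by (auto simp: Int_stable_def)
    show "sets P = sigma_sets UNIV {C. closed C}" "sets Q = sigma_sets UNIV {C. closed C}"
      by (simp_all add: P Q borel_eq_closed)
  qed (use closed_eq in auto)
qed

subsection \<open>Softmax and log-sum-exp\<close>

lemma borel_measurable_linear: "linear L \<Longrightarrow> L \<in> borel_measurable borel"
  for L :: "'a::euclidean_space \<Rightarrow> 'b::euclidean_space"
  by (simp add: linear_conv_bounded_linear borel_measurable_continuous_onI linear_continuous_on)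

lemma integrable_gauss_linear:
  fixes L :: "'a::euclidean_space \<Rightarrow> 'b::euclidean_space"
  assumes "linear L"
  shows "integrable gauss_measure (\<lambda>x. norm (L x))"
proof -
  have L: "bounded_linear L" using assms by (simp add: linear_conv_bounded_linear)
  have [measurable]: "L \<in> borel_measurable borel"
    using assms by (rule borel_measurable_linear)
  obtain K where K: "\<And>x. norm (L x) \<le> norm x * K"
    using bounded_linear.bounded[OF L] by blast
  show ?thesis
    by (rule Bochner_Integration.integrable_bound[OF integrable_mult_left[OF integrable_gauss_norm, of K]])
       (use K in \<open>auto intro: order_trans[OF _ abs_ge_self]\<close>)
qed

lemma integrable_gauss_bounded:
  "g \<in> borel_measurable borel \<Longrightarrow> (\<And>x. \<bar>g x\<bar> \<le> B) \<Longrightarrow> integrable gauss_measure g"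
  for g :: "'a::euclidean_space \<Rightarrow> real"
  by (rule gauss.integrable_const_bound[where B = B]) auto

lemma integrable_gauss_bounded_mult:
  fixes h :: "'a::euclidean_space \<Rightarrow> real"
  assumes [measurable]: "h \<in> borel_measurable borel" and "\<And>x. \<bar>h x\<bar> \<le> B"
  shows "integrable gauss_measure (\<lambda>x. h x * (a \<bullet> x))"
proof (rule Bochner_Integration.integrable_bound)
  show "integrable gauss_measure (\<lambda>x. B * (a \<bullet> x))"
    by (intro integrable_mult_right integrable_gauss_inner)
  show "AE x in gauss_measure. norm (h x * (a \<bullet> x)) \<le> norm (B * (a \<bullet> x))"
    using assms(2) order_trans[OF _ abs_ge_self] by (intro AE_I2) (auto simp: abs_mult intro!: mult_right_mono)
qed simp

text \<open>The Gibbs weights at inverse temperature \<open>\<beta>\<close>; they are the partial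
  derivatives of \<open>logsumexp\<close>.\<close>

definition softmax :: "real \<Rightarrow> 'j set \<Rightarrow> ('j \<Rightarrow> real) \<Rightarrow> 'j \<Rightarrow> real" where
  "softmax \<beta> J s j = exp (\<beta> * s j) / (\<Sum>i\<in>J. exp (\<beta> * s i))"

definition logsumexp :: "real \<Rightarrow> 'j set \<Rightarrow> ('j \<Rightarrow> real) \<Rightarrow> real" where
  "logsumexp \<beta> J s = ln (\<Sum>i\<in>J. exp (\<beta> * s i)) / \<beta>"

lemma sum_exp_pos: "finite J \<Longrightarrow> J \<noteq> {} \<Longrightarrow> 0 < (\<Sum>i\<in>J. exp (g i :: real))"
  by (simp add: sum_pos)

lemma softmax_nonneg: "finite J \<Longrightarrow> 0 \<le> softmax \<beta> J s j"
  unfolding softmax_def by (simp add: sum_nonneg)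

lemma sum_softmax: "finite J \<Longrightarrow> J \<noteq> {} \<Longrightarrow> (\<Sum>j\<in>J. softmax \<beta> J s j) = 1"
  unfolding softmax_def sum_divide_distrib[symmetric]
  using sum_exp_pos[of J "\<lambda>i. \<beta> * s i"] by simp

lemma softmax_le_1: "finite J \<Longrightarrow> j \<in> J \<Longrightarrow> softmax \<beta> J s j \<le> 1"
  using sum_softmax[of J \<beta> s] member_le_sum[of j J "softmax \<beta> J s"] softmax_nonneg[of J \<beta> s]
  by fastforce

lemma softmax_abs_le_1: "finite J \<Longrightarrow> j \<in> J \<Longrightarrow> \<bar>softmax \<beta> J s j\<bar> \<le> 1"
  using softmax_le_1[of J j \<beta> s] softmax_nonneg[of J \<beta> s j] by simp

lemma softmax_average_abs_le:
  assumes "finite J" "\<And>i. i \<in> J \<Longrightarrow> \<bar>d i\<bar> \<le> C"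
  shows "\<bar>\<Sum>i\<in>J. softmax \<beta> J s i * d i\<bar> \<le> real (card J) * C"
proof -
  have "\<bar>\<Sum>i\<in>J. softmax \<beta> J s i * d i\<bar> \<le> (\<Sum>i\<in>J. \<bar>softmax \<beta> J s i * d i\<bar>)" by (rule sum_abs)
  also have "\<dots> \<le> (\<Sum>i\<in>J. 1 * C)"
    using assms softmax_abs_le_1[of J] by (intro sum_mono) (auto simp only: abs_mult intro!: mult_mono)
  finally show ?thesis by simp
qed

lemma DERIV_softmax:
  assumes "finite J" "J \<noteq> {}" "k \<in> J"
    and "\<And>i. i \<in> J \<Longrightarrow> ((\<lambda>t. s i t) has_real_derivative d i) (at t)"
  shows "((\<lambda>t. softmax \<beta> J (\<lambda>i. s i t) k) has_real_derivative
    \<beta> * softmax \<beta> J (\<lambda>i. s i t) k * (d k - (\<Sum>i\<in>J. softmax \<beta> J (\<lambda>i. s i t) i * d i))) (at t)"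
proof -
  let ?D = "\<Sum>i\<in>J. exp (\<beta> * s i t)"
  have D: "?D > 0" by (rule sum_exp_pos) fact+
  have "((\<lambda>t. softmax \<beta> J (\<lambda>i. s i t) k) has_real_derivative
     (exp (\<beta> * s k t) * (\<beta> * d k) * ?D - exp (\<beta> * s k t) * (\<Sum>i\<in>J. exp (\<beta> * s i t) * (\<beta> * d i))) / (?D * ?D)) (at t)"
    unfolding softmax_def using D assms
    by (auto intro!: derivative_eq_intros sum.cong)
  also have "(exp (\<beta> * s k t) * (\<beta> * d k) * ?D - exp (\<beta> * s k t) * (\<Sum>i\<in>J. exp (\<beta> * s i t) * (\<beta> * d i))) / (?D * ?D)
    = \<beta> * softmax \<beta> J (\<lambda>i. s i t) k * (d k - (\<Sum>i\<in>J. softmax \<beta> J (\<lambda>i. s i t) i * d i))"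
  proof -
    have 1: "(\<Sum>i\<in>J. exp (\<beta> * s i t) * (\<beta> * d i)) = \<beta> * (\<Sum>i\<in>J. exp (\<beta> * s i t) * d i)"
      by (simp add: sum_distrib_left algebra_simps)
    have 2: "(\<Sum>i\<in>J. softmax \<beta> J (\<lambda>i. s i t) i * d i) = (\<Sum>i\<in>J. exp (\<beta> * s i t) * d i) / ?D"
      by (simp add: softmax_def sum_divide_distrib)
    show ?thesis unfolding 1 2 unfolding softmax_def using D by (simp add: field_simps)
  qed
  finally show ?thesis .
qed

lemma DERIV_logsumexp:
  assumes "finite J" "J \<noteq> {}" "\<beta> \<noteq> 0"
    and "\<And>i. i \<in> J \<Longrightarrow> ((\<lambda>t. s i t) has_real_derivative d i) (at t)"
  shows "((\<lambda>t. logsumexp \<beta> J (\<lambda>i. s i t)) has_real_derivative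
    (\<Sum>i\<in>J. softmax \<beta> J (\<lambda>i. s i t) i * d i)) (at t)"
proof -
  let ?D = "\<Sum>i\<in>J. exp (\<beta> * s i t)"
  have D: "?D > 0" by (rule sum_exp_pos) fact+
  have "((\<lambda>t. logsumexp \<beta> J (\<lambda>i. s i t)) has_real_derivative
     (\<Sum>i\<in>J. exp (\<beta> * s i t) * (\<beta> * d i)) / ?D / \<beta>) (at t)"
    unfolding logsumexp_def using D assms
    by (auto intro!: derivative_eq_intros sum.cong)
  also have "(\<Sum>i\<in>J. exp (\<beta> * s i t) * (\<beta> * d i)) / ?D / \<beta> = (\<Sum>i\<in>J. softmax \<beta> J (\<lambda>i. s i t) i * d i)"
    using assms(3) by (simp add: softmax_def sum_divide_distrib)
  finally show ?thesis .
qed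

text \<open>The sum of exponentials lies between its largest term and \<open>card J\<close> times
  that term.\<close>

lemma logsumexp_bounds:
  assumes J: "finite J" "J \<noteq> {}" and \<beta>: "\<beta> > 0"
  shows "Max (s ` J) \<le> logsumexp \<beta> J s"
    and "logsumexp \<beta> J s \<le> Max (s ` J) + ln (card J) / \<beta>"
proof -
  have "Max (s ` J) \<in> s ` J" using J by (intro Max_in) auto
  then obtain k where k: "k \<in> J" "Max (s ` J) = s k" by blast
  have le: "s i \<le> s k" if "i \<in> J" for i using that J k(2) Max_ge[of "s ` J" "s i"] by auto
  let ?D = "\<Sum>i\<in>J. exp (\<beta> * s i)"
  have D: "?D > 0" by (rule sum_exp_pos) fact+
  have "exp (\<beta> * s k) \<le> ?D" using J k by (intro member_le_sum) auto
  then have "\<beta> * s k \<le> ln ?D" using D by (simp add: ln_ge_iff)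
  then show "Max (s ` J) \<le> logsumexp \<beta> J s"
    using \<beta> by (simp add: logsumexp_def k(2) field_simps)
  have "?D \<le> (\<Sum>i\<in>J. exp (\<beta> * s k))" using le \<beta> by (intro sum_mono) auto
  then have "?D \<le> card J * exp (\<beta> * s k)" by simp
  then have "ln ?D \<le> ln (card J * exp (\<beta> * s k))"
    using D by (subst ln_le_cancel_iff) auto
  also have "\<dots> = ln (card J) + \<beta> * s k" using J by (subst ln_mult) (auto simp: card_gt_0_iff)
  finally show "logsumexp \<beta> J s \<le> Max (s ` J) + ln (card J) / \<beta>"
    using \<beta> by (simp add: logsumexp_def k(2) field_simps)
qed

text \<open>Because \<open>q\<close> is constant along \<open>a\<close>, the derivative falls on the
  softmax weight alone. This is what allows \<open>q\<close> to contain a gradient that is merely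
  continuous.\<close>

lemma gauss_integration_by_parts_softmax:
  fixes s d :: "'j \<Rightarrow> 'a::euclidean_space \<Rightarrow> real" and \<beta> :: real
  assumes J: "finite J" "J \<noteq> {}" and k: "k \<in> J"
    and s [measurable]: "\<And>j. s j \<in> borel_measurable borel"
    and d [measurable]: "\<And>j. d j \<in> borel_measurable borel"
    and q [measurable]: "q \<in> borel_measurable borel"
    and qK: "\<And>x. \<bar>q x\<bar> \<le> K" and dC: "\<And>j x. j \<in> J \<Longrightarrow> \<bar>d j x\<bar> \<le> C"
    and q_const: "\<And>x t. q (x + t *\<^sub>R a) = q x"
    and deriv: "\<And>j x t. j \<in> J \<Longrightarrow> ((\<lambda>t. s j (x + t *\<^sub>R a)) has_real_derivative d j (x + t *\<^sub>R a)) (at t)"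
  defines "p \<equiv> \<lambda>x. softmax \<beta> J (\<lambda>i. s i x)"
  shows "(\<integral>x. (p x k * q x) * (a \<bullet> x) \<partial>gauss_measure)
    = (\<integral>x. \<beta> * p x k * (d k x - (\<Sum>i\<in>J. p x i * d i x)) * q x \<partial>gauss_measure)"
proof (rule gauss_integration_by_parts)
  have [measurable]: "(\<lambda>x. p x j) \<in> borel_measurable borel" for j
    unfolding p_def softmax_def by measurable
  show "(\<lambda>x. p x k * q x) \<in> borel_measurable borel"
    "(\<lambda>x. \<beta> * p x k * (d k x - (\<Sum>i\<in>J. p x i * d i x)) * q x) \<in> borel_measurable borel"
    by measurable
  have p1: "\<bar>p x j\<bar> \<le> 1" if "j \<in> J" for x j
    unfolding p_def using J that by (intro softmax_abs_le_1)
  have K: "K \<ge> 0" using qK[of 0] by linarith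
  have C: "C \<ge> 0" using dC[OF k, of 0] by linarith
  show "\<bar>p x k * q x\<bar> \<le> 1 * K" for x
    using p1[OF k] qK unfolding abs_mult by (intro mult_mono) auto
  show "\<bar>\<beta> * p x k * (d k x - (\<Sum>i\<in>J. p x i * d i x)) * q x\<bar> \<le> \<bar>\<beta>\<bar> * 1 * (C + card J * C) * K" for x
  proof -
    have "\<bar>d k x - (\<Sum>i\<in>J. p x i * d i x)\<bar> \<le> C + card J * C"
      using dC[OF k, of x] softmax_average_abs_le[of J "\<lambda>i. d i x" C \<beta> "\<lambda>i. s i x"] J dC
      unfolding p_def by (auto intro: order_trans[OF abs_triangle_ineq4])
    then show ?thesis
      using p1[OF k] qK K C unfolding abs_mult by (intro mult_mono) auto
  qed
  show "((\<lambda>t. p (x + t *\<^sub>R a) k * q (x + t *\<^sub>R a)) has_real_derivative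
      \<beta> * p (x + t *\<^sub>R a) k * (d k (x + t *\<^sub>R a) - (\<Sum>i\<in>J. p (x + t *\<^sub>R a) i * d i (x + t *\<^sub>R a)))
       * q (x + t *\<^sub>R a)) (at t)" for x t
    unfolding q_const p_def
    using DERIV_softmax[where s = "\<lambda>j t. s j (x + t *\<^sub>R a)", OF J k deriv]
    by (rule DERIV_cmult_right)
qed

lemma has_real_derivative_inner_chain:
  assumes "(f has_derivative (\<lambda>h. g \<bullet> h)) (at (y t))" "(y has_vector_derivative y') (at t)"
  shows "((\<lambda>t. f (y t)) has_real_derivative g \<bullet> y') (at t)"
proof -
  have "((\<lambda>t. f (y t)) has_derivative (\<lambda>h. g \<bullet> (h *\<^sub>R y'))) (at t)"
    using has_derivative_compose[OF assms(2)[unfolded has_vector_derivative_def]] assms(1) by blast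
  then show ?thesis
    unfolding has_field_derivative_def by (rule has_derivative_eq_rhs) auto
qed

subsection \<open>Interpolation\<close>

text \<open>
  A point \<open>x\<close> of the Gaussian space \<open>'v \<times> ('v ^ 'n) \<times> (real ^ 'n)\<close> stands for a value of
  \<open>(X, (X\<^sub>i), (g\<^sub>i))\<close>; thus \<open>U j\<close>, \<open>V j\<close>, \<open>h j\<close> are \<open>X\<^sub>v\<close>, \<open>\<parallel>v\<parallel> X\<close>, \<open>g\<^sub>v\<close> for \<open>v = v j\<close>.
\<close>

locale smooth_comparison =
  fixes J :: "'j set" and v :: "'j \<Rightarrow> real ^ 'n::finite"
    and f :: "'j \<Rightarrow> 'v::euclidean_space \<Rightarrow> real" and G :: "'j \<Rightarrow> 'v \<Rightarrow> 'v" and \<beta> :: real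
  assumes finite_J: "finite J" and J_nonempty: "J \<noteq> {}" and \<beta>_pos: "\<beta> > 0"
    and f_deriv: "\<And>j y. (f j has_derivative (\<lambda>h. G j y \<bullet> h)) (at y)"
    and G_cont: "\<And>j. continuous_on UNIV (G j)"
    and G_le_1: "\<And>j y. norm (G j y) \<le> 1"
begin

definition U :: "'j \<Rightarrow> 'v \<times> ('v ^ 'n) \<times> (real ^ 'n) \<Rightarrow> 'v" where
  "U j x = (\<Sum>i\<in>UNIV. v j $ i *\<^sub>R fst (snd x) $ i)"

definition V :: "'j \<Rightarrow> 'v \<times> ('v ^ 'n) \<times> (real ^ 'n) \<Rightarrow> 'v" where
  "V j x = norm (v j) *\<^sub>R fst x"

definition h :: "'j \<Rightarrow> 'v \<times> ('v ^ 'n) \<times> (real ^ 'n) \<Rightarrow> real" where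
  "h j x = v j \<bullet> snd (snd x)"

definition Y :: "real \<Rightarrow> 'j \<Rightarrow> 'v \<times> ('v ^ 'n) \<times> (real ^ 'n) \<Rightarrow> 'v" where
  "Y \<theta> j x = sin \<theta> *\<^sub>R U j x + cos \<theta> *\<^sub>R V j x"

definition Y' :: "real \<Rightarrow> 'j \<Rightarrow> 'v \<times> ('v ^ 'n) \<times> (real ^ 'n) \<Rightarrow> 'v" where
  "Y' \<theta> j x = cos \<theta> *\<^sub>R U j x - sin \<theta> *\<^sub>R V j x"

definition S :: "real \<Rightarrow> 'j \<Rightarrow> 'v \<times> ('v ^ 'n) \<times> (real ^ 'n) \<Rightarrow> real" where
  "S \<theta> j x = f j (Y \<theta> j x) + cos \<theta> * h j x"

definition S' :: "real \<Rightarrow> 'j \<Rightarrow> 'v \<times> ('v ^ 'n) \<times> (real ^ 'n) \<Rightarrow> real" where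
  "S' \<theta> j x = G j (Y \<theta> j x) \<bullet> Y' \<theta> j x - sin \<theta> * h j x"

definition p :: "real \<Rightarrow> 'v \<times> ('v ^ 'n) \<times> (real ^ 'n) \<Rightarrow> 'j \<Rightarrow> real" where
  "p \<theta> x = softmax \<beta> J (\<lambda>i. S \<theta> i x)"

definition H :: "real \<Rightarrow> real" where
  "H \<theta> = (\<integral>x. logsumexp \<beta> J (\<lambda>i. S \<theta> i x) \<partial>gauss_measure)"

lemma linear_U: "linear (U j)"
  unfolding U_def by (rule linearI)
    (simp_all add: scaleR_add_right sum.distrib scaleR_sum_right mult.commute)

lemma linear_V: "linear (V j)"
  unfolding V_def by (rule linearI) (simp_all add: scaleR_add_right mult.commute)

lemma linear_h: "linear (h j)"
  unfolding h_def by (rule linearI) (simp_all add: inner_add_right)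

lemma linear_Y: "linear (Y \<theta> j)"
  unfolding Y_def[abs_def]
  by (intro linear_compose_add linear_compose_scale_right linear_U linear_V)

lemma borel_measurable_linear_parts [measurable]:
  "U j \<in> borel_measurable borel" "V j \<in> borel_measurable borel"
  "h j \<in> borel_measurable borel" "Y \<theta> j \<in> borel_measurable borel"
  by (intro borel_measurable_linear linear_U linear_V linear_h linear_Y)+

lemma G_measurable [measurable]: "G j \<in> borel_measurable borel"
  by (rule borel_measurable_continuous_onI[OF G_cont])

lemma f_measurable [measurable]: "f j \<in> borel_measurable borel"
  by (intro borel_measurable_continuous_onI continuous_at_imp_continuous_on ballI
    has_derivative_continuous[OF f_deriv])

lemma borel_measurable_interpolation [measurable]:
  "Y' \<theta> j \<in> borel_measurable borel" "S \<theta> j \<in> borel_measurable borel"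
  "S' \<theta> j \<in> borel_measurable borel" "(\<lambda>x. p \<theta> x j) \<in> borel_measurable borel"
  unfolding Y'_def[abs_def] S_def[abs_def] S'_def[abs_def] p_def softmax_def by measurable

text \<open>The gradient bound makes \<open>f j\<close> 1-Lipschitz, hence of linear growth, which
  is what integrability of \<open>S\<close> rests on.\<close>

lemma f_growth: "\<bar>f j y - f j 0\<bar> \<le> norm y"
proof -
  have "norm (f j y - f j 0) \<le> 1 * norm (y - 0)"
  proof (rule differentiable_bound)
    show "(f j has_derivative (\<lambda>h. G j z \<bullet> h)) (at z within UNIV)" for z by (rule f_deriv)
    show "onorm (\<lambda>h. G j z \<bullet> h) \<le> 1" for z
    proof (rule onorm_le)
      show "norm (G j z \<bullet> h) \<le> 1 * norm h" for h
        using Cauchy_Schwarz_ineq2[of "G j z" h] mult_right_mono[OF G_le_1[of j z] norm_ge_zero[of h]]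
        by simp
    qed
  qed auto
  then show ?thesis by simp
qed

lemma integrable_U: "integrable gauss_measure (\<lambda>x. norm (U j x))"
  by (intro integrable_gauss_linear linear_U)

lemma integrable_V: "integrable gauss_measure (\<lambda>x. norm (V j x))"
  by (intro integrable_gauss_linear linear_V)

lemma integrable_h: "integrable gauss_measure (\<lambda>x. \<bar>h j x\<bar>)"
  using integrable_gauss_linear[OF linear_h, of j] by simp

lemma integrable_S: "integrable gauss_measure (S \<theta> j)"
proof (rule Bochner_Integration.integrable_bound)
  show "integrable gauss_measure (\<lambda>x. \<bar>f j 0\<bar> + norm (Y \<theta> j x) + \<bar>h j x\<bar>)"
    by (intro Bochner_Integration.integrable_add integrable_gauss_linear linear_Y integrable_h) simp
  show "AE x in gauss_measure. norm (S \<theta> j x) \<le> norm (\<bar>f j 0\<bar> + norm (Y \<theta> j x) + \<bar>h j x\<bar>)"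
  proof (rule AE_I2)
    fix x
    have "\<bar>cos \<theta> * h j x\<bar> \<le> \<bar>h j x\<bar>"
      by (simp add: abs_mult mult_left_le_one_le)
    then show "norm (S \<theta> j x) \<le> norm (\<bar>f j 0\<bar> + norm (Y \<theta> j x) + \<bar>h j x\<bar>)"
      using f_growth[of j "Y \<theta> j x"] unfolding S_def real_norm_def by linarith
  qed
qed simp

lemma integrable_Max_S: "integrable gauss_measure (\<lambda>x. Max ((\<lambda>j. S \<theta> j x) ` J))"
  using finite_J J_nonempty by (intro integrable_MAX integrable_S)

lemma integrable_logsumexp_S: "integrable gauss_measure (\<lambda>x. logsumexp \<beta> J (\<lambda>j. S \<theta> j x))"
proof (rule Bochner_Integration.integrable_bound)
  show "integrable gauss_measure (\<lambda>x. \<bar>Max ((\<lambda>j. S \<theta> j x) ` J)\<bar> + ln (card J) / \<beta>)"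
    by (intro Bochner_Integration.integrable_add integrable_abs integrable_Max_S) simp
  show "(\<lambda>x. logsumexp \<beta> J (\<lambda>j. S \<theta> j x)) \<in> borel_measurable gauss_measure"
    unfolding logsumexp_def by measurable
  show "AE x in gauss_measure. norm (logsumexp \<beta> J (\<lambda>j. S \<theta> j x))
      \<le> norm (\<bar>Max ((\<lambda>j. S \<theta> j x) ` J)\<bar> + ln (card J) / \<beta>)"
    using logsumexp_bounds[OF finite_J J_nonempty \<beta>_pos]
    by (intro AE_I2) (smt (verit, best) real_norm_def)
qed

lemma DERIV_S: "((\<lambda>\<theta>. S \<theta> j x) has_real_derivative S' \<theta> j x) (at \<theta>)"
proof -
  have "((\<lambda>\<theta>. Y \<theta> j x) has_vector_derivative Y' \<theta> j x) (at \<theta>)"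
    unfolding Y_def Y'_def by (auto intro!: derivative_eq_intros)
  then have "((\<lambda>\<theta>. f j (Y \<theta> j x)) has_real_derivative G j (Y \<theta> j x) \<bullet> Y' \<theta> j x) (at \<theta>)"
    by (rule has_real_derivative_inner_chain[OF f_deriv])
  then show ?thesis
    unfolding S_def S'_def by (auto intro!: derivative_eq_intros)
qed

lemma S'_bound: "\<bar>S' \<theta> j x\<bar> \<le> norm (U j x) + norm (V j x) + \<bar>h j x\<bar>"
proof -
  have "norm (Y' \<theta> j x) \<le> norm (cos \<theta> *\<^sub>R U j x) + norm (sin \<theta> *\<^sub>R V j x)"
    unfolding Y'_def by (rule norm_triangle_ineq4)
  also have "\<dots> \<le> norm (U j x) + norm (V j x)"
    by (intro add_mono) (simp_all add: mult_left_le_one_le)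
  finally have "\<bar>G j (Y \<theta> j x) \<bullet> Y' \<theta> j x\<bar> \<le> norm (U j x) + norm (V j x)"
    using Cauchy_Schwarz_ineq2[of "G j (Y \<theta> j x)" "Y' \<theta> j x"]
      mult_right_mono[OF G_le_1[of j "Y \<theta> j x"] norm_ge_zero[of "Y' \<theta> j x"]] by linarith
  moreover have "\<bar>sin \<theta> * h j x\<bar> \<le> \<bar>h j x\<bar>"
    by (simp add: abs_mult mult_left_le_one_le)
  ultimately show ?thesis unfolding S'_def by linarith
qed

lemma p_nonneg: "0 \<le> p \<theta> x j"
  unfolding p_def by (rule softmax_nonneg[OF finite_J])

lemma p_sum: "(\<Sum>j\<in>J. p \<theta> x j) = 1"
  unfolding p_def by (rule sum_softmax[OF finite_J J_nonempty])

lemma p_abs_le_1: "j \<in> J \<Longrightarrow> \<bar>p \<theta> x j\<bar> \<le> 1"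
  unfolding p_def by (rule softmax_abs_le_1[OF finite_J])

text \<open>The weights are at most 1 and \<open>S'_bound\<close> is uniform in the angle, so the
  sum of these bounds dominates the derivative for all angles at once.\<close>

lemma DERIV_H: "(H has_real_derivative (\<integral>x. (\<Sum>j\<in>J. p \<theta> x j * S' \<theta> j x) \<partial>gauss_measure)) (at \<theta>)"
  unfolding H_def
proof (rule DERIV_integral_dominated[where e = 1 and
      g = "\<lambda>x. \<Sum>j\<in>J. norm (U j x) + norm (V j x) + \<bar>h j x\<bar>"])
  show "integrable gauss_measure (\<lambda>x. \<Sum>j\<in>J. norm (U j x) + norm (V j x) + \<bar>h j x\<bar>)"
    by (intro Bochner_Integration.integrable_sum Bochner_Integration.integrable_add integrable_U integrable_V integrable_h)
  show "((\<lambda>\<theta>. logsumexp \<beta> J (\<lambda>i. S \<theta> i x)) has_real_derivative (\<Sum>j\<in>J. p t x j * S' t j x)) (at t)" for x t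
    unfolding p_def using finite_J J_nonempty \<beta>_pos DERIV_S by (intro DERIV_logsumexp) auto
  show "\<bar>\<Sum>j\<in>J. p t x j * S' t j x\<bar> \<le> (\<Sum>j\<in>J. norm (U j x) + norm (V j x) + \<bar>h j x\<bar>)" for t x
  proof (rule order_trans[OF sum_abs], rule sum_mono)
    fix j assume "j \<in> J"
    then have "\<bar>p t x j\<bar> * \<bar>S' t j x\<bar> \<le> 1 * \<bar>S' t j x\<bar>"
      by (intro mult_right_mono p_abs_le_1) auto
    then show "\<bar>p t x j * S' t j x\<bar> \<le> norm (U j x) + norm (V j x) + \<bar>h j x\<bar>"
      using S'_bound[of t j x] by (simp add: abs_mult)
  qed
qed (use integrable_logsumexp_S in auto)

section \<open>The sign of the derivative of the interpolation\<close>

text \<open>Per coordinate, the covariance of \<open>U i\<close> and \<open>U j\<close> minus that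
  of \<open>V i\<close> and \<open>V j\<close>. It vanishes on the diagonal, so
  \<open>Y \<theta> j\<close> and \<open>Y' \<theta> j\<close> are uncorrelated.\<close>

definition \<kappa> :: "'j \<Rightarrow> 'j \<Rightarrow> real" where
  "\<kappa> i j = v i \<bullet> v j - norm (v i) * norm (v j)"

text \<open>The vector that represents the linear functional
  \<open>\<lambda>x. b \<bullet> Y' \<theta> j x\<close> as an inner product; it is the direction in
  which to integrate by parts.\<close>

definition dir :: "real \<Rightarrow> 'j \<Rightarrow> 'v \<Rightarrow> 'v \<times> ('v ^ 'n) \<times> (real ^ 'n)" where
  "dir \<theta> j b = (- (sin \<theta> * norm (v j)) *\<^sub>R b, (\<chi> i. (cos \<theta> * v j $ i) *\<^sub>R b), 0)"

lemma dir_inner: "dir \<theta> j b \<bullet> x = b \<bullet> Y' \<theta> j x"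
  by (cases x) (simp add: dir_def Y'_def U_def V_def inner_vec_def inner_diff_right
    inner_sum_right sum_distrib_left mult.assoc inner_commute)

text \<open>Evaluating \<open>Y \<theta> i\<close> at the representing vector gives the covariance
  of \<open>Y \<theta> i\<close> with \<open>b \<bullet> Y' \<theta> j\<close>; the terms in
  \<open>sin\<close> and \<open>cos\<close> combine into \<open>\<kappa>\<close>.\<close>

lemma Y_dir: "Y \<theta> i (dir \<theta> j b) = (sin \<theta> * cos \<theta> * \<kappa> i j) *\<^sub>R b"
proof -
  have "U i (dir \<theta> j b) = (cos \<theta> * (v i \<bullet> v j)) *\<^sub>R b"
    by (simp add: U_def dir_def inner_vec_def scaleR_sum_left sum_distrib_left mult_ac)
  then show ?thesis
    by (simp add: Y_def V_def dir_def \<kappa>_def algebra_simps)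
qed

lemma h_dir: "h i (dir \<theta> j b) = 0"
  by (simp add: h_def dir_def)

lemma \<kappa>_self: "\<kappa> j j = 0"
  by (simp add: \<kappa>_def dot_square_norm power2_eq_square)

lemma \<kappa>_le_0: "\<kappa> i j \<le> 0"
  using norm_cauchy_schwarz[of "v i" "v j"] by (simp add: \<kappa>_def)

lemma DERIV_S_line:
  "((\<lambda>t. S \<theta> j (x + t *\<^sub>R a)) has_real_derivative
     G j (Y \<theta> j (x + t *\<^sub>R a)) \<bullet> Y \<theta> j a + cos \<theta> * h j a) (at t)"
proof -
  have Y: "Y \<theta> j (x + t *\<^sub>R a) = Y \<theta> j x + t *\<^sub>R Y \<theta> j a" for t
    by (simp add: linear_add[OF linear_Y] linear_scale[OF linear_Y])
  have h: "h j (x + t *\<^sub>R a) = h j x + t * h j a" for t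
    by (simp add: linear_add[OF linear_h] linear_scale[OF linear_h])
  have "((\<lambda>t. Y \<theta> j (x + t *\<^sub>R a)) has_vector_derivative Y \<theta> j a) (at t)"
    unfolding Y by (auto intro!: derivative_eq_intros)
  then have "((\<lambda>t. f j (Y \<theta> j (x + t *\<^sub>R a))) has_real_derivative
      G j (Y \<theta> j (x + t *\<^sub>R a)) \<bullet> Y \<theta> j a) (at t)"
    by (rule has_real_derivative_inner_chain[OF f_deriv])
  then show ?thesis
    unfolding S_def h by (auto intro!: derivative_eq_intros)
qed

lemma G_inner_abs_le: "\<bar>G j y \<bullet> b\<bar> \<le> norm b"
  using Cauchy_Schwarz_ineq2[of "G j y" b] mult_right_mono[OF G_le_1[of j y] norm_ge_zero[of b]]
  by linarith

lemma softmax_integration_by_parts: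
  assumes k: "k \<in> J" and [measurable]: "q \<in> borel_measurable borel"
    and "\<And>x. \<bar>q x\<bar> \<le> K" "\<And>x t. q (x + t *\<^sub>R a) = q x"
  shows "(\<integral>x. (p \<theta> x k * q x) * (a \<bullet> x) \<partial>gauss_measure)
    = (\<integral>x. \<beta> * p \<theta> x k * ((G k (Y \<theta> k x) \<bullet> Y \<theta> k a + cos \<theta> * h k a)
        - (\<Sum>i\<in>J. p \<theta> x i * (G i (Y \<theta> i x) \<bullet> Y \<theta> i a + cos \<theta> * h i a))) * q x \<partial>gauss_measure)"
proof -
  let ?C = "\<Sum>i\<in>J. norm (Y \<theta> i a) + \<bar>cos \<theta> * h i a\<bar>"
  have "\<bar>G j (Y \<theta> j x) \<bullet> Y \<theta> j a + cos \<theta> * h j a\<bar> \<le> ?C" if "j \<in> J" for j x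
  proof -
    have "norm (Y \<theta> j a) + \<bar>cos \<theta> * h j a\<bar> \<le> ?C"
      using that finite_J by (intro member_le_sum) auto
    then show ?thesis using G_inner_abs_le[of j "Y \<theta> j x" "Y \<theta> j a"] by linarith
  qed
  then show ?thesis
    unfolding p_def
    using gauss_integration_by_parts_softmax[OF finite_J J_nonempty k, of "S \<theta>"
      "\<lambda>i x. G i (Y \<theta> i x) \<bullet> Y \<theta> i a + cos \<theta> * h i a" q K ?C a \<beta>] DERIV_S_line assms
    by simp
qed

text \<open>Integration by parts in the direction \<open>dir \<theta> k b\<close>. Since
  \<open>\<kappa> k k = 0\<close>, this direction does not move \<open>Y \<theta> k\<close>: the
  gradient factor is constant along it, and the term of the index \<open>k\<close> itself drops
  out.\<close>

lemma integral_softmax_Y':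
  assumes k: "k \<in> J"
  shows "(\<integral>x. (p \<theta> x k * (G k (Y \<theta> k x) \<bullet> b)) * (b \<bullet> Y' \<theta> k x) \<partial>gauss_measure)
    = (\<integral>x. - \<beta> * (sin \<theta> * cos \<theta>) * (\<Sum>i\<in>J. p \<theta> x k * p \<theta> x i * \<kappa> i k *
          ((G i (Y \<theta> i x) \<bullet> b) * (G k (Y \<theta> k x) \<bullet> b))) \<partial>gauss_measure)"
proof -
  have "Y \<theta> k (x + t *\<^sub>R dir \<theta> k b) = Y \<theta> k x" for x t
    by (simp add: linear_add[OF linear_Y] linear_scale[OF linear_Y] Y_dir \<kappa>_self)
  then have "(\<integral>x. (p \<theta> x k * (G k (Y \<theta> k x) \<bullet> b)) * (b \<bullet> Y' \<theta> k x) \<partial>gauss_measure)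
    = (\<integral>x. \<beta> * p \<theta> x k * ((G k (Y \<theta> k x) \<bullet> Y \<theta> k (dir \<theta> k b) + cos \<theta> * h k (dir \<theta> k b))
        - (\<Sum>i\<in>J. p \<theta> x i * (G i (Y \<theta> i x) \<bullet> Y \<theta> i (dir \<theta> k b) + cos \<theta> * h i (dir \<theta> k b))))
        * (G k (Y \<theta> k x) \<bullet> b) \<partial>gauss_measure)"
    unfolding dir_inner[symmetric]
    by (intro softmax_integration_by_parts[OF k, where K = "norm b"]) (auto simp: G_inner_abs_le)
  also have "\<dots> = (\<integral>x. - \<beta> * (sin \<theta> * cos \<theta>) * (\<Sum>i\<in>J. p \<theta> x k * p \<theta> x i * \<kappa> i k *
          ((G i (Y \<theta> i x) \<bullet> b) * (G k (Y \<theta> k x) \<bullet> b))) \<partial>gauss_measure)"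
    by (intro Bochner_Integration.integral_cong refl)
       (simp add: Y_dir h_dir \<kappa>_self sum_distrib_left sum_distrib_right sum_negf mult_ac)
  finally show ?thesis .
qed

text \<open>The direction \<open>(0, 0, v k)\<close> represents \<open>h k\<close> and moves no
  \<open>Y \<theta> i\<close>, so only the covariances of the \<open>h i\<close> appear.\<close>

lemma integral_softmax_h:
  assumes k: "k \<in> J"
  shows "(\<integral>x. p \<theta> x k * h k x \<partial>gauss_measure)
    = (\<integral>x. \<beta> * cos \<theta> * (p \<theta> x k * (v k \<bullet> v k - (\<Sum>i\<in>J. p \<theta> x i * (v i \<bullet> v k)))) \<partial>gauss_measure)"
proof -
  let ?a = "(0, 0, v k) :: 'v \<times> ('v ^ 'n) \<times> (real ^ 'n)"
  have Y: "Y \<theta> i ?a = 0" for i by (simp add: Y_def U_def V_def)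
  have hh: "h i ?a = v i \<bullet> v k" for i by (simp add: h_def)
  have "(\<integral>x. (p \<theta> x k * 1) * (?a \<bullet> x) \<partial>gauss_measure)
    = (\<integral>x. \<beta> * p \<theta> x k * ((G k (Y \<theta> k x) \<bullet> Y \<theta> k ?a + cos \<theta> * h k ?a)
        - (\<Sum>i\<in>J. p \<theta> x i * (G i (Y \<theta> i x) \<bullet> Y \<theta> i ?a + cos \<theta> * h i ?a))) * 1 \<partial>gauss_measure)"
    by (rule softmax_integration_by_parts[OF k, where K = 1]) auto
  also have "(\<lambda>x. ?a \<bullet> x) = h k" by (auto simp: h_def fun_eq_iff)
  also have "(\<lambda>x. \<beta> * p \<theta> x k * ((G k (Y \<theta> k x) \<bullet> Y \<theta> k ?a + cos \<theta> * h k ?a)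
        - (\<Sum>i\<in>J. p \<theta> x i * (G i (Y \<theta> i x) \<bullet> Y \<theta> i ?a + cos \<theta> * h i ?a))) * 1)
    = (\<lambda>x. \<beta> * cos \<theta> * (p \<theta> x k * (v k \<bullet> v k - (\<Sum>i\<in>J. p \<theta> x i * (v i \<bullet> v k)))))"
    by (simp add: Y hh fun_eq_iff algebra_simps sum_distrib_left)
  finally show ?thesis by simp
qed

text \<open>The pointwise sign behind the monotonicity, for fixed weights and gradients. As the
  weights sum to 1, the second term symmetrises to half the weighted double sum of the squared
  distances of \<open>v i\<close> and \<open>v k\<close>, which outweighs the nonpositive
  \<open>\<kappa> i k\<close>.\<close>

lemma weighted_pair_nonneg:
  assumes w0: "\<And>j. w j \<ge> 0" and w1: "(\<Sum>j\<in>J. w j) = 1" and g: "\<And>j. norm (g j :: 'v) \<le> 1"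
  shows "0 \<le> (\<Sum>k\<in>J. \<Sum>i\<in>J. w k * w i * \<kappa> i k * (g i \<bullet> g k))
     + (\<Sum>k\<in>J. w k * (v k \<bullet> v k - (\<Sum>i\<in>J. w i * (v i \<bullet> v k))))" (is "0 \<le> ?A + ?B")
proof -
  let ?N = "\<lambda>k. (norm (v k))\<^sup>2"
  \<comment> \<open>Total weight 1 spreads a single sum over both indices; the average of the two
    versions is the symmetric one.\<close>
  have 1: "(\<Sum>k\<in>J. \<Sum>i\<in>J. w k * w i * ?N k) = (\<Sum>k\<in>J. w k * ?N k)"
    using w1 by (simp add: sum_distrib_left[symmetric] sum_distrib_right[symmetric])
  have 2: "(\<Sum>k\<in>J. \<Sum>i\<in>J. w k * w i * ?N i) = (\<Sum>k\<in>J. w k * ?N k)"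
    by (subst sum.swap) (simp add: 1 mult.commute[of "w _" "w _"] cong: sum.cong)
  have "?B = (\<Sum>k\<in>J. w k * ?N k) - (\<Sum>k\<in>J. \<Sum>i\<in>J. w k * w i * (v i \<bullet> v k))"
    by (simp add: right_diff_distrib sum_subtractf dot_square_norm sum_distrib_left mult_ac)
  also have "(\<Sum>k\<in>J. w k * ?N k) = (\<Sum>k\<in>J. \<Sum>i\<in>J. w k * w i * ((?N k + ?N i) / 2))"
    using 1 2 by (simp add: distrib_left add_divide_distrib sum.distrib sum_divide_distrib[symmetric])
  finally have "?A + ?B = (\<Sum>k\<in>J. \<Sum>i\<in>J. w k * w i * (\<kappa> i k * (g i \<bullet> g k) + (?N k + ?N i) / 2 - v i \<bullet> v k))"
    by (simp add: sum.distrib sum_subtractf algebra_simps)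
  moreover have "0 \<le> \<kappa> i k * (g i \<bullet> g k) + (?N k + ?N i) / 2 - v i \<bullet> v k" for i k
  proof -
    have "g i \<bullet> g k \<le> norm (g i) * norm (g k)" by (rule norm_cauchy_schwarz)
    also have "\<dots> \<le> 1 * 1" using g by (intro mult_mono) auto
    finally have "\<kappa> i k * 1 \<le> \<kappa> i k * (g i \<bullet> g k)"
      using \<kappa>_le_0[of i k] by (intro mult_left_mono_neg) auto
    moreover have "\<kappa> i k + (?N k + ?N i) / 2 - v i \<bullet> v k = (norm (v i) - norm (v k))\<^sup>2 / 2"
      by (simp add: \<kappa>_def power2_eq_square field_simps)
    ultimately show ?thesis
      using zero_le_power2[of "norm (v i) - norm (v k)"] by linarith
  qed
  ultimately show ?thesis using w0 by (simp add: sum_nonneg)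
qed

text \<open>Both integrations by parts produce the common factor
  \<open>- \<beta> * (sin \<theta> * cos \<theta>)\<close>, nonpositive for the angles considered;
  what remains is nonnegative pointwise by \<open>weighted_pair_nonneg\<close>.\<close>

lemma DERIV_H_nonpos:
  assumes "0 \<le> sin \<theta>" "0 \<le> cos \<theta>"
  shows "(\<integral>x. (\<Sum>j\<in>J. p \<theta> x j * S' \<theta> j x) \<partial>gauss_measure) \<le> 0"
proof -
  let ?Q = "\<lambda>k b x. \<Sum>i\<in>J. p \<theta> x k * p \<theta> x i * \<kappa> i k * ((G i (Y \<theta> i x) \<bullet> b) * (G k (Y \<theta> k x) \<bullet> b))"
  let ?R = "\<lambda>k x. p \<theta> x k * (v k \<bullet> v k - (\<Sum>i\<in>J. p \<theta> x i * (v i \<bullet> v k)))"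
  have int1: "integrable gauss_measure (\<lambda>x. (p \<theta> x k * (G k (Y \<theta> k x) \<bullet> b)) * (b \<bullet> Y' \<theta> k x))"
    if "k \<in> J" for k b
    unfolding dir_inner[symmetric]
  proof (rule integrable_gauss_bounded_mult)
    show "\<bar>p \<theta> x k * (G k (Y \<theta> k x) \<bullet> b)\<bar> \<le> 1 * norm b" for x
      unfolding abs_mult using p_abs_le_1[OF that] G_inner_abs_le by (intro mult_mono) auto
  qed simp
  have int2: "integrable gauss_measure (\<lambda>x. p \<theta> x k * h k x)" if "k \<in> J" for k
    by (rule Bochner_Integration.integrable_bound[OF integrable_h[of k]])
       (use p_abs_le_1[OF that] in \<open>auto simp: abs_mult mult_left_le_one_le\<close>)
  have intQ: "integrable gauss_measure (?Q k b)" if "k \<in> J" for k b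
  proof (intro Bochner_Integration.integrable_sum integrable_gauss_bounded)
    fix i x assume "i \<in> J"
    then show "\<bar>p \<theta> x k * p \<theta> x i * \<kappa> i k * ((G i (Y \<theta> i x) \<bullet> b) * (G k (Y \<theta> k x) \<bullet> b))\<bar>
        \<le> 1 * 1 * \<bar>\<kappa> i k\<bar> * (norm b * norm b)"
      unfolding abs_mult using p_abs_le_1 that G_inner_abs_le by (intro mult_mono) auto
  qed simp
  have intR: "integrable gauss_measure (?R k)" if "k \<in> J" for k
  proof (rule integrable_gauss_bounded)
    fix x
    have "\<bar>\<Sum>i\<in>J. p \<theta> x i * (v i \<bullet> v k)\<bar> \<le> (\<Sum>i\<in>J. 1 * \<bar>v i \<bullet> v k\<bar>)"
      by (rule order_trans[OF sum_abs], rule sum_mono, unfold abs_mult)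
         (intro mult_right_mono p_abs_le_1, auto)
    then have "\<bar>v k \<bullet> v k - (\<Sum>i\<in>J. p \<theta> x i * (v i \<bullet> v k))\<bar> \<le> \<bar>v k \<bullet> v k\<bar> + (\<Sum>i\<in>J. 1 * \<bar>v i \<bullet> v k\<bar>)"
      by linarith
    then show "\<bar>?R k x\<bar> \<le> 1 * (\<bar>v k \<bullet> v k\<bar> + (\<Sum>i\<in>J. 1 * \<bar>v i \<bullet> v k\<bar>))"
      unfolding abs_mult using p_abs_le_1[OF that] by (intro mult_mono) auto
  qed simp
  \<comment> \<open>Expanding \<open>G \<bullet> Y'\<close> in the orthonormal basis brings each
    term into the form treated by \<open>integral_softmax_Y'\<close>.\<close>
  have "(\<integral>x. (\<Sum>j\<in>J. p \<theta> x j * S' \<theta> j x) \<partial>gauss_measure)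
      = (\<integral>x. (\<Sum>k\<in>J. (\<Sum>b\<in>Basis. (p \<theta> x k * (G k (Y \<theta> k x) \<bullet> b)) * (b \<bullet> Y' \<theta> k x))
           - sin \<theta> * (p \<theta> x k * h k x)) \<partial>gauss_measure)"
    unfolding S'_def
    by (subst euclidean_inner) (simp add: sum_distrib_left algebra_simps inner_commute)
  also have "\<dots> = (\<Sum>k\<in>J. (\<Sum>b\<in>Basis. \<integral>x. (p \<theta> x k * (G k (Y \<theta> k x) \<bullet> b)) * (b \<bullet> Y' \<theta> k x) \<partial>gauss_measure)
           - sin \<theta> * (\<integral>x. p \<theta> x k * h k x \<partial>gauss_measure))"
    using int1 int2 by simp
  also have "\<dots> = (\<Sum>k\<in>J. (\<Sum>b\<in>Basis. - \<beta> * (sin \<theta> * cos \<theta>) * (\<integral>x. ?Q k b x \<partial>gauss_measure))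
           - sin \<theta> * (\<beta> * cos \<theta> * (\<integral>x. ?R k x \<partial>gauss_measure)))"
    by (intro sum.cong refl) (simp add: integral_softmax_Y' integral_softmax_h)
  also have "\<dots> = - \<beta> * (sin \<theta> * cos \<theta>) *
      ((\<Sum>k\<in>J. \<Sum>b\<in>Basis. \<integral>x. ?Q k b x \<partial>gauss_measure) + (\<Sum>k\<in>J. \<integral>x. ?R k x \<partial>gauss_measure))"
    by (simp add: sum_distrib_left sum.distrib sum_negf sum_subtractf algebra_simps)
  also have "(\<Sum>k\<in>J. \<Sum>b\<in>Basis. \<integral>x. ?Q k b x \<partial>gauss_measure) + (\<Sum>k\<in>J. \<integral>x. ?R k x \<partial>gauss_measure)
      = (\<integral>x. (\<Sum>k\<in>J. \<Sum>b\<in>Basis. ?Q k b x) + (\<Sum>k\<in>J. ?R k x) \<partial>gauss_measure)"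
    using intQ intR by simp
  also have "- \<beta> * (sin \<theta> * cos \<theta>) * \<dots> \<le> 0"
  proof -
    have "0 \<le> (\<Sum>k\<in>J. \<Sum>b\<in>Basis. ?Q k b x) + (\<Sum>k\<in>J. ?R k x)" for x
    proof -
      \<comment> \<open>Summation over the basis turns the products of coordinates back into inner
        products of gradients.\<close>
      have "(\<Sum>b\<in>Basis. ?Q k b x) = (\<Sum>i\<in>J. p \<theta> x k * p \<theta> x i * \<kappa> i k * (G i (Y \<theta> i x) \<bullet> G k (Y \<theta> k x)))" for k
        by (subst sum.swap, subst euclidean_inner) (simp add: sum_distrib_left)
      then show ?thesis
        using weighted_pair_nonneg[of "p \<theta> x" "\<lambda>i. G i (Y \<theta> i x)"] p_nonneg p_sum G_le_1 by simp
    qed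
    then show ?thesis using assms \<beta>_pos
      by (intro mult_nonpos_nonneg integral_nonneg) auto
  qed
  finally show ?thesis .
qed

text \<open>\<open>H\<close> decreases from angle 0, where \<open>S\<close> is
  \<open>f j (V j x) + h j x\<close>, to \<open>pi / 2\<close>, where it is
  \<open>f j (U j x)\<close>. Since \<open>logsumexp\<close> dominates the maximum, its error is
  paid only at angle 0.\<close>

lemma Max_comparison_approx:
  "(\<integral>x. Max ((\<lambda>j. f j (U j x)) ` J) \<partial>gauss_measure)
    \<le> (\<integral>x. Max ((\<lambda>j. f j (V j x) + h j x) ` J) \<partial>gauss_measure) + ln (card J) / \<beta>"
proof -
  have "H (pi / 2) \<le> H 0"
  proof (rule DERIV_nonpos_imp_nonincreasing[where f = H and a = 0 and b = "pi / 2"])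
    fix \<theta> :: real assume that: "0 \<le> \<theta>" "\<theta> \<le> pi / 2"
    show "\<exists>y. (H has_real_derivative y) (at \<theta>) \<and> y \<le> 0"
      using DERIV_H[of \<theta>] DERIV_H_nonpos[of \<theta>] sin_ge_zero[of \<theta>] cos_ge_zero[of \<theta>] that by auto
  qed simp
  moreover have "(\<integral>x. Max ((\<lambda>j. S (pi / 2) j x) ` J) \<partial>gauss_measure) \<le> H (pi / 2)"
    unfolding H_def using finite_J J_nonempty \<beta>_pos
    by (intro integral_mono integrable_Max_S integrable_logsumexp_S logsumexp_bounds)
  moreover have "H 0 \<le> (\<integral>x. Max ((\<lambda>j. S 0 j x) ` J) + ln (card J) / \<beta> \<partial>gauss_measure)"
    unfolding H_def using finite_J J_nonempty \<beta>_pos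
    by (intro integral_mono Bochner_Integration.integrable_add integrable_Max_S integrable_logsumexp_S logsumexp_bounds) auto
  moreover have "(\<integral>x. Max ((\<lambda>j. S 0 j x) ` J) + ln (card J) / \<beta> \<partial>gauss_measure)
      = (\<integral>x. Max ((\<lambda>j. S 0 j x) ` J) \<partial>gauss_measure) + ln (card J) / \<beta>"
    using integrable_Max_S[of 0] by (simp add: gauss.prob_space[simplified])
  ultimately show ?thesis
    by (simp add: S_def Y_def)
qed

end

section \<open>From smooth functions to finite maxima of cones\<close>

lemma Max_comparison:
  fixes v :: "'j \<Rightarrow> real ^ 'n::finite" and z :: "'j \<Rightarrow> 'v::euclidean_space"
  assumes J: "finite J" "J \<noteq> {}"
  defines "U \<equiv> \<lambda>j (x :: 'v \<times> ('v ^ 'n) \<times> (real ^ 'n)). \<Sum>i\<in>UNIV. v j $ i *\<^sub>R fst (snd x) $ i"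
    and "V \<equiv> \<lambda>j (x :: 'v \<times> ('v ^ 'n) \<times> (real ^ 'n)). norm (v j) *\<^sub>R fst x"
    and "h \<equiv> \<lambda>j (x :: 'v \<times> ('v ^ 'n) \<times> (real ^ 'n)). v j \<bullet> snd (snd x)"
  shows "integrable gauss_measure (\<lambda>x. Max ((\<lambda>j. c j - norm (U j x - z j)) ` J))"
    and "integrable gauss_measure (\<lambda>x. Max ((\<lambda>j. c j - norm (V j x - z j) + h j x) ` J))"
    and "(\<integral>x. Max ((\<lambda>j. c j - norm (U j x - z j)) ` J) \<partial>gauss_measure)
      \<le> (\<integral>x. Max ((\<lambda>j. c j - norm (V j x - z j) + h j x) ` J) \<partial>gauss_measure)"
proof -
  have lin: "linear (U j)" "linear (V j)" "linear (h j)" for j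
    unfolding U_def V_def h_def
    by (auto intro!: linearI simp: scaleR_add_right sum.distrib scaleR_sum_right inner_add_right mult.commute)
  have int_dist: "integrable gauss_measure (\<lambda>x. norm (L x - b))"
    if L: "linear L" for L :: "'v \<times> ('v ^ 'n) \<times> (real ^ 'n) \<Rightarrow> 'v" and b
  proof (rule Bochner_Integration.integrable_bound)
    show "integrable gauss_measure (\<lambda>x. norm (L x) + norm b)"
      by (intro Bochner_Integration.integrable_add integrable_gauss_linear[OF L]) simp
    have [measurable]: "L \<in> borel_measurable borel"
      using L by (rule borel_measurable_linear)
    show "(\<lambda>x. norm (L x - b)) \<in> borel_measurable gauss_measure" by simp
    show "AE x in gauss_measure. norm (norm (L x - b)) \<le> norm (norm (L x) + norm b)"
      using norm_triangle_ineq4 by (intro AE_I2) auto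
  qed
  have [measurable]: "h j \<in> borel_measurable borel" for j
    by (rule borel_measurable_linear[OF lin(3)])
  have int_h: "integrable gauss_measure (h j)" for j
    by (rule integrable_norm_cancel[OF integrable_gauss_linear[OF lin(3)]]) simp
  have intU: "integrable gauss_measure (\<lambda>x. c j - norm (U j x - z j))"
    and intV: "integrable gauss_measure (\<lambda>x. c j - norm (V j x - z j) + h j x)" for j
    by (intro Bochner_Integration.integrable_add Bochner_Integration.integrable_diff int_dist lin int_h; simp)+
  show 1: "integrable gauss_measure (\<lambda>x. Max ((\<lambda>j. c j - norm (U j x - z j)) ` J))"
    and 2: "integrable gauss_measure (\<lambda>x. Max ((\<lambda>j. c j - norm (V j x - z j) + h j x) ` J))"
    by (rule integrable_MAX[OF J intU], rule integrable_MAX[OF J intV])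
  show "(\<integral>x. Max ((\<lambda>j. c j - norm (U j x - z j)) ` J) \<partial>gauss_measure)
      \<le> (\<integral>x. Max ((\<lambda>j. c j - norm (V j x - z j) + h j x) ` J) \<partial>gauss_measure)"
  proof (rule field_le_epsilon)
    fix e :: real assume e: "e > 0"
    \<comment> \<open>The smoothing of the norm and that of the maximum each cost at most
      \<open>e / 2\<close>. The added 1 keeps \<open>\<beta>\<close> positive when \<open>J\<close>
      is a singleton.\<close>
    define \<delta> where "\<delta> = e / 2"
    define \<beta> where "\<beta> = 2 * (ln (card J) + 1) / e"
    have card: "ln (card J) \<ge> 0" using J by (simp add: Suc_le_eq card_gt_0_iff)
    have \<delta>: "\<delta> > 0" and \<beta>: "\<beta> > 0" using e card by (simp_all add: \<delta>_def \<beta>_def add_nonneg_pos)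
    have small: "ln (card J) / \<beta> + \<delta> \<le> e"
      using e card \<beta> by (simp add: \<delta>_def \<beta>_def field_simps)
    \<comment> \<open>A regularised distance to \<open>z j\<close>: positive everywhere, so its
      gradient is continuous, and at most \<open>\<delta>\<close> above the true distance.\<close>
    define r where "r j y = sqrt (\<delta>\<^sup>2 + (y - z j) \<bullet> (y - z j))" for j y
    define f where "f j y = c j - r j y" for j y
    define G where "G j y = - (y - z j) /\<^sub>R r j y" for j y
    have pos: "0 < \<delta>\<^sup>2 + (y - z j) \<bullet> (y - z j)" for j y
      using \<delta> by (simp add: add_pos_nonneg)
    then have r_pos: "r j y > 0" for j y by (simp add: r_def)
    have r_ge: "norm (y - z j) \<le> r j y" for j y
      unfolding r_def norm_eq_sqrt_inner by simp
    have r_le: "r j y \<le> norm (y - z j) + \<delta>" for j y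
      unfolding r_def using \<delta>
      by (intro real_le_lsqrt) (simp_all add: power2_sum dot_square_norm)
    have r_deriv: "(r j has_derivative (\<lambda>h. ((y - z j) /\<^sub>R r j y) \<bullet> h)) (at y)" for j y
    proof -
      have "((\<lambda>y. \<delta>\<^sup>2 + (y - z j) \<bullet> (y - z j)) has_derivative (\<lambda>h. 2 * ((y - z j) \<bullet> h))) (at y)"
        by (auto intro!: derivative_eq_intros simp: fun_eq_iff inner_commute)
      from has_derivative_real_sqrt[OF _ this]
      have "((\<lambda>y. sqrt (\<delta>\<^sup>2 + (y - z j) \<bullet> (y - z j))) has_derivative
          (\<lambda>h. 2 * ((y - z j) \<bullet> h) * (inverse (r j y) / 2))) (at y)"
        using pos[of y j] by (simp add: r_def)
      then show ?thesis
        by (simp add: r_def[abs_def] mult.commute)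
    qed
    interpret sc: smooth_comparison J v f G \<beta>
    proof
      show "(f j has_derivative (\<lambda>h. G j y \<bullet> h)) (at y)" for j y
        unfolding f_def G_def
        by (rule has_derivative_eq_rhs[OF has_derivative_diff[OF has_derivative_const r_deriv]])
           (simp add: fun_eq_iff inner_diff_left algebra_simps)
      show "continuous_on UNIV (G j)" for j
        unfolding G_def r_def using pos by (intro continuous_intros) (auto simp: less_le)
      show "norm (G j y) \<le> 1" for j y
      proof -
        have "norm (G j y) = norm (y - z j) / r j y"
          unfolding G_def norm_scaleR norm_minus_cancel using r_pos[of j y] by (simp add: divide_inverse)
        then show ?thesis using r_pos[of j y] r_ge[of y j] by simp
      qed
    qed (use J \<beta> in auto)
    have UVh: "sc.U j x = U j x" "sc.V j x = V j x" "sc.h j x = h j x" for j x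
      unfolding sc.U_def sc.V_def sc.h_def U_def V_def h_def by auto
    show "(\<integral>x. Max ((\<lambda>j. c j - norm (U j x - z j)) ` J) \<partial>gauss_measure)
      \<le> (\<integral>x. Max ((\<lambda>j. c j - norm (V j x - z j) + h j x) ` J) \<partial>gauss_measure) + e"
    proof -
      let ?M = "\<lambda>s x. Max ((\<lambda>j. s j x) ` J)"
      have mono: "Max (s ` J) \<le> Max (s' ` J) + b" if "\<And>j. s j \<le> s' j + b" for s s' :: "'j \<Rightarrow> real" and b
      proof (subst Max_le_iff)
        show "\<forall>a\<in>s ` J. a \<le> Max (s' ` J) + b"
        proof
          fix a assume "a \<in> s ` J"
          then obtain j where j: "j \<in> J" "a = s j" by blast
          then have "s' j \<le> Max (s' ` J)" using J by (intro Max_ge) auto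
          then show "a \<le> Max (s' ` J) + b" using that[of j] j by linarith
        qed
      qed (use J in auto)
      have intfU: "integrable gauss_measure (?M (\<lambda>j x. f j (U j x)))"
        using sc.integrable_Max_S[of "pi / 2"] by (simp add: sc.S_def sc.Y_def UVh)
      have intfV: "integrable gauss_measure (?M (\<lambda>j x. f j (V j x) + h j x))"
        using sc.integrable_Max_S[of 0] by (simp add: sc.S_def sc.Y_def UVh)
      \<comment> \<open>Smoothing only lowers the cones. Hence \<open>\<delta>\<close> is paid here
        once, while its removal on the other side below is free.\<close>
      have "(\<integral>x. ?M (\<lambda>j x. c j - norm (U j x - z j)) x \<partial>gauss_measure)
          \<le> (\<integral>x. ?M (\<lambda>j x. f j (U j x)) x + \<delta> \<partial>gauss_measure)"
        using r_le by (intro integral_mono 1 Bochner_Integration.integrable_add intfU mono)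
          (simp_all add: f_def algebra_simps)
      also have "\<dots> = (\<integral>x. ?M (\<lambda>j x. f j (U j x)) x \<partial>gauss_measure) + \<delta>"
        using intfU by (simp add: gauss.prob_space[simplified])
      also have "\<dots> \<le> (\<integral>x. ?M (\<lambda>j x. f j (V j x) + h j x) x \<partial>gauss_measure) + ln (card J) / \<beta> + \<delta>"
        using sc.Max_comparison_approx by (simp add: UVh)
      also have "(\<integral>x. ?M (\<lambda>j x. f j (V j x) + h j x) x \<partial>gauss_measure)
          \<le> (\<integral>x. ?M (\<lambda>j x. c j - norm (V j x - z j) + h j x) x \<partial>gauss_measure)"
        using mono[of _ _ 0] r_ge by (intro integral_mono 2 intfV) (simp add: f_def)
      finally show ?thesis using small by simp
    qed
  qed
qed

subsection \<open>The law of a canonical Gaussian family\<close>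

lemma real_gaussian_integrable:
  assumes M: "prob_space M" and Y: "real_gaussian M Y"
  shows "integrable M Y" "integrable M (\<lambda>w. (Y w)\<^sup>2)"
proof -
  interpret prob_space M by fact
  have [measurable]: "Y \<in> borel_measurable M" using Y by (simp add: real_gaussian_def)
  consider (const) c where "AE w in M. Y w = c"
    | (normal) \<mu> \<sigma> where "\<sigma> > 0" "distributed M lborel Y (normal_density \<mu> \<sigma>)"
    using Y by (auto simp: real_gaussian_def)
  then have "integrable M Y \<and> integrable M (\<lambda>w. (Y w)\<^sup>2)"
  proof cases
    case const
    have "integrable M Y"
      by (rule integrable_const_bound[where B = "\<bar>c\<bar>"]) (use const in auto)
    moreover have "integrable M (\<lambda>w. (Y w)\<^sup>2)"
      by (rule integrable_const_bound[where B = "c\<^sup>2"]) (use const in auto)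
    ultimately show ?thesis ..
  next
    case normal
    have "integrable M (\<lambda>w. (Y w - \<mu>) ^ k)" for k
      using integrable_normal_moment[OF normal(1), of \<mu> k]
      by (subst distributed_integrable[OF normal(2), symmetric]) (auto simp: normal_density_nonneg)
    from this[of 1] this[of 2]
    have 1: "integrable M (\<lambda>w. Y w - \<mu>)" and 2: "integrable M (\<lambda>w. (Y w - \<mu>)\<^sup>2)" by simp_all
    have "integrable M (\<lambda>w. (Y w - \<mu>) + \<mu>)"
      by (intro Bochner_Integration.integrable_add 1 integrable_const)
    moreover have "integrable M (\<lambda>w. (Y w - \<mu>)\<^sup>2 + (2 * \<mu> * (Y w - \<mu>) + \<mu>\<^sup>2))"
      by (intro Bochner_Integration.integrable_add 1 2 integrable_mult_right integrable_const)
    moreover have "(Y w - \<mu>)\<^sup>2 + (2 * \<mu> * (Y w - \<mu>) + \<mu>\<^sup>2) = (Y w)\<^sup>2" for w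
      by (simp add: power2_eq_square algebra_simps)
    ultimately show ?thesis by simp
  qed
  then show "integrable M Y" "integrable M (\<lambda>w. (Y w)\<^sup>2)" by auto
qed

text \<open>Mean zero forces the constant to be 0 in the degenerate case and
  \<open>\<mu> = 0\<close> in the other one; the latter rescales to the standard normal law.\<close>

lemma char_centered_real_gaussian:
  assumes M: "prob_space M" and Y: "real_gaussian M Y" and mean: "(\<integral>w. Y w \<partial>M) = 0"
  shows "char (distr M borel Y) 1 = of_real (exp (- (\<integral>w. (Y w)\<^sup>2 \<partial>M) / 2))"
proof -
  interpret prob_space M by fact
  have [measurable]: "Y \<in> borel_measurable M" using Y by (simp add: real_gaussian_def)
  have char_Y: "char (distr M borel Y) 1 = (CLINT w|M. iexp (Y w))"
    by (simp add: char_def integral_distr)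
  consider (const) c where "AE w in M. Y w = c"
    | (normal) \<mu> \<sigma> where "\<sigma> > 0" "distributed M lborel Y (normal_density \<mu> \<sigma>)"
    using Y by (auto simp: real_gaussian_def)
  then show ?thesis
  proof cases
    case const
    then have "(\<integral>w. Y w \<partial>M) = (\<integral>w. c \<partial>M)" by (intro integral_cong_AE) auto
    with mean have "c = 0" by (simp add: prob_space)
    with const have c: "AE w in M. Y w = 0" by simp
    then have "(\<integral>w. (Y w)\<^sup>2 \<partial>M) = (\<integral>w. 0 \<partial>M)" by (intro integral_cong_AE) auto
    moreover from c have "(CLINT w|M. iexp (Y w)) = (CLINT w|M. 1)" by (intro integral_cong_AE) auto
    ultimately show ?thesis by (simp add: char_Y prob_space)
  next
    case normal
    have \<mu>: "\<mu> = 0" using normal_distributed_expectation[OF normal] mean by simp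
    have \<sigma>: "(\<integral>w. (Y w)\<^sup>2 \<partial>M) = \<sigma>\<^sup>2" using normal_distributed_variance[OF normal] mean by simp
    have "distributed M lborel (\<lambda>w. Y w / \<sigma>) std_normal_density"
      using normal normal_standard_normal_convert[of \<sigma> Y 0] \<mu> by simp
    then have d: "distr M lborel (\<lambda>w. Y w / \<sigma>) = std_normal_distribution"
      by (simp add: distributed_def)
    have "char std_normal_distribution \<sigma> = (CLINT w|M. iexp (Y w))"
      unfolding d[symmetric] using normal(1) by (simp add: char_def integral_distr)
    then show ?thesis
      by (simp add: char_Y char_std_normal_distribution \<sigma>)
  qed
qed

text \<open>The coordinates are square integrable, so the variance of \<open>u \<bullet> X w\<close>
  expands into entries of the covariance matrix and equals \<open>u \<bullet> u\<close>. The
  frequency is absorbed into \<open>u\<close>, so evaluation at 1 suffices; \<open>u = 0\<close> is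
  a degenerate marginal.\<close>

lemma char_canonical_gaussian:
  assumes M: "prob_space M" and X: "canonical_gaussian M (X :: _ \<Rightarrow> real ^ 'd)"
  shows "char (distr M borel (\<lambda>w. u \<bullet> X w)) 1 = of_real (exp (- (u \<bullet> u) / 2))"
proof -
  have g: "real_gaussian M (\<lambda>w. a \<bullet> X w)" for a
    using X by (simp add: canonical_gaussian_def gaussian_vector_def)
  have gk: "real_gaussian M (\<lambda>w. X w $ k)" for k
    using g[of "axis k 1"] by (simp add: inner_axis')
  have mean: "(\<integral>w. X w $ k \<partial>M) = 0" for k
    using X by (simp add: canonical_gaussian_def mean_vector_def vec_eq_iff)
  have "(\<integral>w. X w $ k * X w $ l \<partial>M) = (mat 1 :: real^'d^'d) $ k $ l" for k l
    using X unfolding canonical_gaussian_def covariance_matrix_def by (auto simp: vec_eq_iff)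
  then have cov: "(\<integral>w. X w $ k * X w $ l \<partial>M) = (if k = l then 1 else 0)" for k l
    by (simp add: mat_def)
  have int: "integrable M (\<lambda>w. X w $ k)" for k
    by (rule real_gaussian_integrable[OF M gk])
  have int2: "integrable M (\<lambda>w. X w $ k * X w $ l)" for k l
  proof (rule Bochner_Integration.integrable_bound)
    show "integrable M (\<lambda>w. (X w $ k)\<^sup>2 + (X w $ l)\<^sup>2)"
      by (intro Bochner_Integration.integrable_add real_gaussian_integrable[OF M gk])
    show "(\<lambda>w. X w $ k * X w $ l) \<in> borel_measurable M"
      using int by (intro borel_measurable_times) auto
    show "AE w in M. norm (X w $ k * X w $ l) \<le> norm ((X w $ k)\<^sup>2 + (X w $ l)\<^sup>2)"
    proof (rule AE_I2)
      fix w
      have "2 * (\<bar>X w $ k\<bar> * \<bar>X w $ l\<bar>) \<le> (X w $ k)\<^sup>2 + (X w $ l)\<^sup>2"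
        using sum_squares_bound[of "\<bar>X w $ k\<bar>" "\<bar>X w $ l\<bar>"] by (simp add: mult.assoc)
      moreover have "0 \<le> \<bar>X w $ k\<bar> * \<bar>X w $ l\<bar>" by simp
      ultimately show "norm (X w $ k * X w $ l) \<le> norm ((X w $ k)\<^sup>2 + (X w $ l)\<^sup>2)"
        unfolding real_norm_def abs_mult by linarith
    qed
  qed
  have 1: "(\<integral>w. u \<bullet> X w \<partial>M) = 0"
    by (simp add: inner_vec_def int mean)
  have "(\<integral>w. (u \<bullet> X w)\<^sup>2 \<partial>M) = (\<integral>w. (\<Sum>k\<in>UNIV. \<Sum>l\<in>UNIV. (u $ k * u $ l) * (X w $ k * X w $ l)) \<partial>M)"
    by (simp add: inner_vec_def power2_eq_square sum_product mult_ac)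
  also have "\<dots> = (\<Sum>k\<in>UNIV. \<Sum>l\<in>UNIV. (u $ k * u $ l) * (if k = l then 1 else 0))"
    by (simp only: Bochner_Integration.integral_sum Bochner_Integration.integrable_sum
      integrable_mult_right integral_mult_right_zero int2 cov)
  also have "\<dots> = u \<bullet> u"
    by (simp add: inner_vec_def if_distrib cong: if_cong)
  finally have 2: "(\<integral>w. (u \<bullet> X w)\<^sup>2 \<partial>M) = u \<bullet> u" .
  show ?thesis
    using char_centered_real_gaussian[OF M g 1] by (simp add: 2)
qed

lemma measurable_vec_lambda [measurable (raw)]:
  fixes f :: "'n::finite \<Rightarrow> 'w \<Rightarrow> 'a::euclidean_space"
  assumes [measurable]: "\<And>i. f i \<in> borel_measurable M"
  shows "(\<lambda>w. \<chi> i. f i w) \<in> borel_measurable M"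
proof (subst borel_measurable_euclidean_space, intro ballI)
  fix b :: "'a ^ 'n" assume "b \<in> Basis"
  then obtain i u where "b = axis i u" by (auto simp: Basis_vec_def)
  then show "(\<lambda>w. (\<chi> i. f i w) \<bullet> b) \<in> borel_measurable M"
    by (simp add: inner_axis)
qed

text \<open>The hypothesis fixes the characteristic function of \<open>W\<close>. Its real and
  imaginary parts give the integrals of cosine and sine, and the addition formula supplies the phase
  required by \<open>measure_eqI_cos\<close>.\<close>

lemma distr_eq_gauss_measure:
  fixes W :: "'w \<Rightarrow> 'a::euclidean_space"
  assumes M: "prob_space M" and [measurable]: "W \<in> borel_measurable M"
    and char_W: "\<And>u. char (distr M borel (\<lambda>w. u \<bullet> W w)) 1 = of_real (exp (- (u \<bullet> u) / 2))"
  shows "distr M borel W = gauss_measure"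
proof (rule measure_eqI_cos)
  interpret prob_space M by fact
  show "prob_space (distr M borel W)" by (rule prob_space_distr) simp
  show "prob_space (gauss_measure :: 'a measure)" by (rule prob_space_gauss_measure)
  show "(\<integral>x. cos (u \<bullet> x + c) \<partial>distr M borel W) = (\<integral>x. cos (u \<bullet> x + c) \<partial>gauss_measure)" for u c
  proof -
    have int: "integrable M (\<lambda>w. iexp (u \<bullet> W w))"
      by (intro integrable_iexp) auto
    have ch: "(CLINT w|M. iexp (u \<bullet> W w)) = of_real (exp (- (u \<bullet> u) / 2))"
      using char_W[of u] by (simp add: char_def integral_distr)
    have Re: "(\<integral>w. cos (u \<bullet> W w) \<partial>M) = exp (- (u \<bullet> u) / 2)"
      using integral_Re[OF int] unfolding ch by (simp add: Re_exp)
    have Im: "(\<integral>w. sin (u \<bullet> W w) \<partial>M) = 0"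
      using integral_Im[OF int] unfolding ch by (simp add: Im_exp)
    have [simp]: "integrable M (\<lambda>w. cos (u \<bullet> W w))" "integrable M (\<lambda>w. sin (u \<bullet> W w))"
      by (auto intro!: integrable_const_bound[where B = 1])
    have "(\<integral>x. cos (u \<bullet> x + c) \<partial>distr M borel W) = (\<integral>w. cos (u \<bullet> W w) * cos c - sin (u \<bullet> W w) * sin c \<partial>M)"
      by (simp add: integral_distr cos_add)
    also have "\<dots> = exp (- (u \<bullet> u) / 2) * cos c"
      by (simp add: Re Im)
    finally show ?thesis by (simp add: gauss_cos mult.commute)
  qed
qed simp_all

lemma sigma_sets_vimage_subset:
  assumes h: "h \<in> measurable R K" and "space R = S"
  shows "sigma_sets S {h -` A \<inter> S |A. A \<in> sets K} \<subseteq> sets R"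
proof -
  have "{h -` A \<inter> S |A. A \<in> sets K} \<subseteq> sets R"
    using measurable_sets[OF h] assms(2) by auto
  then show ?thesis using sets.sigma_sets_subset[of _ R] assms(2) by simp
qed

text \<open>Measurable functions of \<open>X\<close> and of \<open>Y\<close> generate
  sub-sigma-algebras of those generated by \<open>X\<close> and \<open>Y\<close>, and independence
  passes to them.\<close>

lemma (in prob_space) indep_var_compose_vimage_algebra:
  assumes ind: "indep_set (sets (vimage_algebra (space M) X N)) (sets (vimage_algebra (space M) Y L))"
    and X: "X \<in> measurable M N" and Y: "Y \<in> measurable M L"
    and f: "f \<in> measurable N S" and g: "g \<in> measurable L T"
  shows "indep_var S (\<lambda>w. f (X w)) T (\<lambda>w. g (Y w))"
proof -
  have fX: "(\<lambda>w. f (X w)) \<in> measurable (vimage_algebra (space M) X N) S"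
    using X by (intro measurable_compose[OF _ f] measurable_vimage_algebra1) (auto simp: measurable_def)
  have gY: "(\<lambda>w. g (Y w)) \<in> measurable (vimage_algebra (space M) Y L) T"
    using Y by (intro measurable_compose[OF _ g] measurable_vimage_algebra1) (auto simp: measurable_def)
  show ?thesis
    unfolding indep_var_eq
  proof (intro conjI)
    show "random_variable S (\<lambda>w. f (X w))" by (rule measurable_compose[OF X f])
    show "random_variable T (\<lambda>w. g (Y w))" by (rule measurable_compose[OF Y g])
    show "indep_set (sigma_sets (space M) {(\<lambda>w. f (X w)) -` A \<inter> space M |A. A \<in> sets S})
        (sigma_sets (space M) {(\<lambda>w. g (Y w)) -` A \<inter> space M |A. A \<in> sets T})"
      using ind unfolding indep_set_def
      by (rule indep_sets_mono_sets) (use sigma_sets_vimage_subset[OF fX] sigma_sets_vimage_subset[OF gY] in \<open>auto split: bool.split\<close>)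
  qed
qed

text \<open>A linear functional of \<open>W\<close> splits into a combination \<open>Z\<close> of
  \<open>X\<close> and the \<open>Xs i\<close> and a combination \<open>Z'\<close> of the
  \<open>g i\<close>. Independence within each family and between the two makes its characteristic
  function a product of Gaussian ones.\<close>

lemma distr_gaussian_family:
  fixes X :: "'w \<Rightarrow> real ^ 'd" and Xs :: "'n::finite \<Rightarrow> 'w \<Rightarrow> real ^ 'd" and g :: "'n \<Rightarrow> 'w \<Rightarrow> real"
  assumes M: "prob_space M"
    and X: "canonical_gaussian M X"
    and Xs: "\<And>i. canonical_gaussian M (Xs i)"
    and ind_X: "prob_space.indep_vars M (\<lambda>_. borel) (case_option X Xs) UNIV"
    and g: "\<And>i. distributed M lborel (g i) std_normal_density"
    and ind_g: "prob_space.indep_vars M (\<lambda>_. borel) g UNIV"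
    and ind: "prob_space.indep_set M
           (sets (vimage_algebra (space M) (\<lambda>w i. g i w) (Pi\<^sub>M UNIV (\<lambda>_. borel))))
           (sets (vimage_algebra (space M) (\<lambda>w k. case_option X Xs k w) (Pi\<^sub>M UNIV (\<lambda>_. borel))))"
  defines "W \<equiv> \<lambda>w. (X w, (\<chi> i. Xs i w), (\<chi> i. g i w))"
  shows "W \<in> borel_measurable M" "distr M borel W = gauss_measure"
proof -
  interpret prob_space M by fact
  have [measurable]: "X \<in> borel_measurable M" "Xs i \<in> borel_measurable M" for i
    using X Xs by (auto simp: canonical_gaussian_def gaussian_vector_def)
  have [measurable]: "g i \<in> borel_measurable M" for i
    using g[of i] by (simp add: distributed_def)
  have opt [measurable]: "case_option X Xs k \<in> borel_measurable M" for k
    by (cases k) auto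
  show W [measurable]: "W \<in> borel_measurable M"
    unfolding W_def by measurable
  show "distr M borel W = gauss_measure"
  proof (rule distr_eq_gauss_measure[OF M W])
    fix u :: "(real ^ 'd) \<times> ((real ^ 'd) ^ 'n) \<times> (real ^ 'n)"
    obtain a b e where u: "u = (a, b, e)" by (cases u) auto
    \<comment> \<open>The index \<open>None\<close> carries the coefficient of \<open>X\<close>, as
      in \<open>case_option X Xs\<close>.\<close>
    define c where "c k = (case k of None \<Rightarrow> a | Some i \<Rightarrow> b $ i)" for k
    define Z where "Z w = (\<Sum>k\<in>UNIV. c k \<bullet> case_option X Xs k w)" for w
    define Z' where "Z' w = (\<Sum>i\<in>UNIV. e $ i * g i w)" for w
    have sum_opt: "(\<Sum>k\<in>UNIV. h k) = h None + (\<Sum>i\<in>UNIV. h (Some i))" for h :: "'n option \<Rightarrow> real"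
      by (simp add: UNIV_option_conv sum.reindex)
    have "char (distr M borel Z) 1 = (\<Prod>k\<in>UNIV. char (distr M borel (\<lambda>w. c k \<bullet> case_option X Xs k w)) 1)"
      unfolding Z_def
      by (intro char_distr_sum indep_vars_compose2[OF ind_X]) auto
    also have "\<dots> = (\<Prod>k\<in>UNIV. of_real (exp (- (c k \<bullet> c k) / 2)))"
      by (intro prod.cong refl char_canonical_gaussian M) (auto simp: X Xs split: option.split)
    also have "\<dots> = of_real (exp (- (a \<bullet> a + b \<bullet> b) / 2))"
      unfolding of_real_prod[symmetric]
      by (simp add: exp_sum[symmetric] sum_opt sum_negf sum_divide_distrib[symmetric] inner_vec_def[of b] c_def
        add_divide_distrib)
    finally have charZ: "char (distr M borel Z) 1 = of_real (exp (- (a \<bullet> a + b \<bullet> b) / 2))" .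
    have "char (distr M borel (\<lambda>w. e $ i * g i w)) 1 = of_real (exp (- (e $ i)\<^sup>2 / 2))" for i
    proof -
      have "distr M lborel (g i) = std_normal_distribution"
        using g[of i] by (simp add: distributed_def)
      then have "char std_normal_distribution (e $ i) = (CLINT w|M. iexp (e $ i * g i w))"
        by (simp add: char_def integral_distr flip: \<open>distr M lborel (g i) = std_normal_distribution\<close>)
      then show ?thesis
        by (simp add: char_std_normal_distribution char_def integral_distr)
    qed
    then have "char (distr M borel Z') 1 = (\<Prod>i\<in>UNIV. of_real (exp (- (e $ i)\<^sup>2 / 2)))"
      unfolding Z'_def
      by (subst char_distr_sum) (auto intro!: indep_vars_compose2[OF ind_g])
    also have "\<dots> = of_real (exp (- (e \<bullet> e) / 2))"
      unfolding of_real_prod[symmetric]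
      by (simp add: exp_sum[symmetric] sum_negf sum_divide_distrib[symmetric] inner_vec_def power2_eq_square)
    finally have charZ': "char (distr M borel Z') 1 = of_real (exp (- (e \<bullet> e) / 2))" .
    have "indep_var borel Z' borel Z"
      unfolding Z_def[abs_def] Z'_def[abs_def]
    proof (rule indep_var_compose_vimage_algebra[OF ind,
          where f = "\<lambda>x. \<Sum>i\<in>UNIV. e $ i * x i" and g = "\<lambda>x. \<Sum>k\<in>UNIV. c k \<bullet> x k"])
      show "(\<lambda>w i. g i w) \<in> measurable M (Pi\<^sub>M UNIV (\<lambda>_. borel))"
        "(\<lambda>w k. case_option X Xs k w) \<in> measurable M (Pi\<^sub>M UNIV (\<lambda>_. borel))"
        by (intro measurable_PiM_single'; simp)+
    qed measurable
    then have "char (distr M borel (\<lambda>w. Z' w + Z w)) 1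
        = of_real (exp (- (e \<bullet> e) / 2)) * of_real (exp (- (a \<bullet> a + b \<bullet> b) / 2))"
      by (simp only: char_distr_add charZ charZ')
    also have "\<dots> = of_real (exp (- (u \<bullet> u) / 2))"
    proof -
      have "- (e \<bullet> e) / 2 + - (a \<bullet> a + b \<bullet> b) / 2 = - (u \<bullet> u) / 2"
        by (simp add: u field_simps)
      then show ?thesis by (simp only: of_real_mult[symmetric] exp_add[symmetric])
    qed
    also have "(\<lambda>w. Z' w + Z w) = (\<lambda>w. u \<bullet> W w)"
      unfolding Z_def Z'_def sum_opt by (simp add: fun_eq_iff u W_def c_def inner_vec_def)
    finally show "char (distr M borel (\<lambda>w. u \<bullet> W w)) 1 = of_real (exp (- (u \<bullet> u) / 2))" .
  qed
qed

subsection \<open>Suprema and extended expectations\<close>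

text \<open>For each rational \<open>q\<close> the sets where a member exceeds \<open>q\<close> are
  open, so by Lindelof countably many have the same union. Collecting these over all
  \<open>q\<close> suffices, since a gap between the two suprema would contain a rational.\<close>

lemma countable_SUP_subfamily:
  fixes \<phi> :: "'i \<Rightarrow> 'a::second_countable_topology \<Rightarrow> real"
  assumes cont: "\<And>i. i \<in> I \<Longrightarrow> continuous_on UNIV (\<phi> i)"
  obtains I' where "I' \<subseteq> I" "countable I'" "\<And>x. (SUP i\<in>I'. ereal (\<phi> i x)) = (SUP i\<in>I. ereal (\<phi> i x))"
proof -
  define O' where "O' q i = {x. real_of_rat q < \<phi> i x}" for q i
  have "\<exists>K. countable K \<and> K \<subseteq> I \<and> \<Union>(O' q ` K) = \<Union>(O' q ` I)" for q
  proof -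
    have "open S" if "S \<in> O' q ` I" for S
      using that cont by (auto simp: O'_def intro!: open_Collect_less)
    then obtain \<F> where \<F>: "\<F> \<subseteq> O' q ` I" "countable \<F>" "\<Union>\<F> = \<Union>(O' q ` I)"
      by (rule Lindelof)
    have "countable \<F> \<and> \<F> \<subseteq> O' q ` I" using \<F> by (intro conjI)
    then obtain K where "countable K" "K \<subseteq> I" "\<F> = O' q ` K"
      unfolding countable_subset_image by (elim exE conjE)
    then show ?thesis using \<F>(3) by (intro exI[of _ K]) simp
  qed
  then obtain K where K: "\<And>q. countable (K q)" "\<And>q. K q \<subseteq> I" "\<And>q. \<Union>(O' q ` K q) = \<Union>(O' q ` I)"
    by metis
  show ?thesis
  proof
    show "(\<Union>q. K q) \<subseteq> I" "countable (\<Union>q. K q)" using K by auto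
    fix x
    show "(SUP i\<in>\<Union>q. K q. ereal (\<phi> i x)) = (SUP i\<in>I. ereal (\<phi> i x))" (is "?l = ?r")
    proof (rule antisym)
      show "?l \<le> ?r" using K(2) by (intro SUP_subset_mono) auto
      show "?r \<le> ?l"
      proof (rule ccontr)
        assume "\<not> ?r \<le> ?l"
        then obtain i where i: "i \<in> I" "?l < ereal (\<phi> i x)"
          by (auto simp: not_le less_SUP_iff)
        then obtain q where q: "?l < ereal (real_of_rat q)" "ereal (real_of_rat q) < ereal (\<phi> i x)"
          using ereal_dense3 by blast
        then have "x \<in> \<Union>(O' q ` K q)" using i unfolding K(3) by (auto simp: O'_def)
        then obtain k where k: "k \<in> K q" "real_of_rat q < \<phi> k x"
          by (auto simp: O'_def)
        then have "ereal (\<phi> k x) \<le> ?l" by (intro SUP_upper) auto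
        from le_less_trans[OF this q(1)] show False using k by simp
      qed
    qed
  qed
qed

text \<open>Both parts are monotone for arbitrary functions, so a supremum over an uncountable set
  can be compared directly.\<close>

lemma ext_expectation_mono:
  assumes "\<And>w. w \<in> space M \<Longrightarrow> f w \<le> f' w"
  shows "ext_expectation M f \<le> ext_expectation M f'"
  unfolding ext_expectation_def
  using assms
  by (intro ereal_minus_mono nn_integral_mono less_eq_ennreal.rep_eq[THEN iffD1] e2ennreal_mono) auto

lemma e2ennreal_ereal_eq: "e2ennreal (ereal x) = ennreal x"
  by (simp add: ennreal.abs_eq)

lemma ext_expectation_real:
  assumes f: "integrable M f"
  shows "ext_expectation M (\<lambda>w. ereal (f w)) = ereal (\<integral>w. f w \<partial>M)"
proof -
  have fin: "(\<integral>\<^sup>+w. ennreal (f w) \<partial>M) \<noteq> \<infinity>" "(\<integral>\<^sup>+w. ennreal (- f w) \<partial>M) \<noteq> \<infinity>"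
    using f by (simp_all add: real_integrable_def)
  have "enn2ereal a = ereal (enn2real a)" if "a \<noteq> \<infinity>" for a
    using that by (cases a) auto
  with fin show ?thesis
    unfolding ext_expectation_def uminus_ereal.simps e2ennreal_ereal_eq
    by (simp add: real_lebesgue_integral_def[OF f])
qed

text \<open>Positive parts converge monotonically. Negative parts decrease and are dominated by that
  of the integrable \<open>f 0\<close>; their limit is finite, which excludes
  \<open>\<infinity> - \<infinity>\<close> in the difference.\<close>

lemma ext_expectation_SUP_le:
  fixes f :: "nat \<Rightarrow> 'w \<Rightarrow> real"
  assumes f: "\<And>n. integrable M (f n)" and inc: "\<And>w. incseq (\<lambda>n. f n w)"
    and le: "\<And>n. ereal (\<integral>w. f n w \<partial>M) \<le> c"
  shows "ext_expectation M (\<lambda>w. SUP n. ereal (f n w)) \<le> c"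
proof -
  have [measurable]: "f n \<in> borel_measurable M" for n using f by auto
  have lim: "(\<lambda>n. ereal (f n w)) \<longlonglongrightarrow> (SUP n. ereal (f n w))" for w
    using inc by (intro LIMSEQ_SUP) (auto simp: incseq_def)
  have fin: "(\<integral>\<^sup>+w. ennreal (- f 0 w) \<partial>M) < \<infinity>"
    using f[of 0] by (simp add: real_integrable_def less_top)
  let ?N = "\<integral>\<^sup>+w. e2ennreal (- (SUP n. ereal (f n w))) \<partial>M"
  have "?N \<le> (\<integral>\<^sup>+w. ennreal (- f 0 w) \<partial>M)"
  proof (intro nn_integral_mono)
    fix w
    have "- (SUP n. ereal (f n w)) \<le> - ereal (f 0 w)"
      unfolding ereal_minus_le_minus by (rule SUP_upper) simp
    then have "e2ennreal (- (SUP n. ereal (f n w))) \<le> e2ennreal (- ereal (f 0 w))"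
      by (rule e2ennreal_mono)
    then show "e2ennreal (- (SUP n. ereal (f n w))) \<le> ennreal (- f 0 w)"
      by (simp only: uminus_ereal.simps e2ennreal_ereal_eq)
  qed
  with fin have N: "?N \<noteq> \<infinity>" by (auto simp: top_unique)
  have P_lim: "(\<lambda>n. \<integral>\<^sup>+w. e2ennreal (ereal (f n w)) \<partial>M) \<longlonglongrightarrow> (\<integral>\<^sup>+w. e2ennreal (SUP n. ereal (f n w)) \<partial>M)"
    using inc by (intro nn_integral_LIMSEQ tendsto_e2ennrealI lim)
      (auto simp: incseq_def le_fun_def e2ennreal_ereal_eq intro!: ennreal_leI)
  have N_lim: "(\<lambda>n. \<integral>\<^sup>+w. e2ennreal (- ereal (f n w)) \<partial>M) \<longlonglongrightarrow> ?N"
  proof (rule nn_integral_dominated_convergence[where w = "\<lambda>w. ennreal (- f 0 w)"])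
    show "AE w in M. e2ennreal (- ereal (f n w)) \<le> ennreal (- f 0 w)" for n
      using inc by (intro AE_I2) (auto simp: e2ennreal_ereal_eq incseq_def intro!: ennreal_leI)
    show "AE w in M. (\<lambda>n. e2ennreal (- ereal (f n w))) \<longlonglongrightarrow> e2ennreal (- (SUP n. ereal (f n w)))"
      by (intro AE_I2 tendsto_e2ennrealI tendsto_uminus_ereal lim)
  qed (use fin in auto)
  have "(\<lambda>n. ext_expectation M (\<lambda>w. ereal (f n w))) \<longlonglongrightarrow> ext_expectation M (\<lambda>w. SUP n. ereal (f n w))"
    unfolding ext_expectation_def
    using N by (intro tendsto_diff_ereal_general tendsto_enn2erealI P_lim N_lim) auto
  then show ?thesis
    using le by (intro LIMSEQ_le_const2) (auto simp: ext_expectation_real f)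
qed

text \<open>The Lipschitz bound says that no cone rises above \<open>f\<close>, and the cone with
  apex at \<open>y\<close> attains the value.\<close>

lemma SUP_lipschitz_minus_dist:
  fixes f :: "'a::real_normed_vector \<Rightarrow> real"
  assumes "1-lipschitz_on UNIV f"
  shows "(SUP z. ereal (f z - norm (y - z))) = ereal (f y)"
proof (rule antisym)
  have "f z - norm (y - z) \<le> f y" for z
    using lipschitz_onD[OF assms, of z y] by (simp add: dist_norm norm_minus_commute)
  then show "(SUP z. ereal (f z - norm (y - z))) \<le> ereal (f y)"
    by (intro SUP_least) simp
  show "ereal (f y) \<le> (SUP z. ereal (f z - norm (y - z)))"
    by (rule SUP_upper2[of y]) auto
qed

theorem theorem1:
  fixes M :: "'w measure"
    and X :: "'w \<Rightarrow> real ^ 'd"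
    and Xs :: "'n::finite \<Rightarrow> 'w \<Rightarrow> real ^ 'd"
    and g :: "'n \<Rightarrow> 'w \<Rightarrow> real"
    and A :: "(real ^ 'n) set"
    and F :: "real ^ 'n \<Rightarrow> real ^ 'd \<Rightarrow> real"
  assumes "prob_space M"
    and "canonical_gaussian M X"
    and "\<And>i. canonical_gaussian M (Xs i)"
    and "prob_space.indep_vars M (\<lambda>_. borel) (case_option X Xs) UNIV"
    and "\<And>i. distributed M lborel (g i) std_normal_density"
    and "prob_space.indep_vars M (\<lambda>_. borel) g UNIV"
    and "prob_space.indep_set M
           (sets (vimage_algebra (space M) (\<lambda>w i. g i w) (Pi\<^sub>M UNIV (\<lambda>_. borel))))
           (sets (vimage_algebra (space M) (\<lambda>w k. case_option X Xs k w) (Pi\<^sub>M UNIV (\<lambda>_. borel))))"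
    and "A \<noteq> {}" and "A \<subseteq> cball 0 1"
    and "\<And>x. x \<in> A \<Longrightarrow> 1-lipschitz_on UNIV (F x)"
  shows "ext_expectation M (\<lambda>w. SUP x\<in>A. ereal (F x (\<Sum>i\<in>UNIV. x $ i *\<^sub>R Xs i w)))
       \<le> ext_expectation M (\<lambda>w. SUP x\<in>A. ereal (F x (norm x *\<^sub>R X w) + (\<Sum>i\<in>UNIV. x $ i * g i w)))"
    (is "_ \<le> ?R")
proof -
  define W where "W w = (X w, (\<chi> i. Xs i w), (\<chi> i. g i w))" for w
  note W = distr_gaussian_family[OF assms(1-7), folded W_def[abs_def]]
  note W(1)[measurable]
  \<comment> \<open>For a pair \<open>(x, z)\<close>, \<open>\<phi>\<close> and
    \<open>\<psi>\<close> evaluate the cone of \<open>F x\<close> with apex \<open>z\<close> on the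
    Gaussian space, on the left and on the right side respectively; \<open>\<psi>\<close> also
    carries the term of the \<open>g i\<close>.\<close>
  define \<phi> where "\<phi> = (\<lambda>(x, z) (\<xi> :: (real ^ 'd) \<times> ((real ^ 'd) ^ 'n) \<times> (real ^ 'n)).
     F x z - norm ((\<Sum>i\<in>UNIV. x $ i *\<^sub>R fst (snd \<xi>) $ i) - z))"
  define \<psi> where "\<psi> = (\<lambda>(x, z) (\<xi> :: (real ^ 'd) \<times> ((real ^ 'd) ^ 'n) \<times> (real ^ 'n)).
     F x z - norm (norm x *\<^sub>R fst \<xi> - z) + x \<bullet> snd (snd \<xi>))"
  have "continuous_on UNIV (\<phi> j)" for j
    unfolding \<phi>_def by (cases j) (auto intro!: continuous_intros)
  then obtain I where I: "I \<subseteq> A \<times> UNIV" "countable I"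
    and SUP_I: "\<And>\<xi>. (SUP j\<in>I. ereal (\<phi> j \<xi>)) = (SUP j\<in>A \<times> UNIV. ereal (\<phi> j \<xi>))"
    using countable_SUP_subfamily[of "A \<times> UNIV" \<phi>] by blast
  \<comment> \<open>Nonemptiness makes \<open>from_nat_into I\<close> take all its values in
    \<open>I\<close>, also beyond the cardinality of a finite \<open>I\<close>. An empty
    \<open>I\<close> would give the supremum \<open>-\<infinity>\<close>.\<close>
  have "I \<noteq> {}"
  proof
    assume "I = {}"
    then have "(SUP j\<in>A \<times> UNIV. ereal (\<phi> j 0)) = -\<infinity>"
      using SUP_I[of 0] by (simp add: bot_ereal_def)
    moreover obtain x where "x \<in> A" using assms(8) by blast
    then have "ereal (\<phi> (x, 0) 0) \<le> (SUP j\<in>A \<times> UNIV. ereal (\<phi> j 0))" by (intro SUP_upper) auto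
    ultimately show False by simp
  qed
  define J where "J n = from_nat_into I ` {..n}" for n :: nat
  have J: "finite (J n)" "J n \<noteq> {}" "J n \<subseteq> I" for n
    using from_nat_into[OF \<open>I \<noteq> {}\<close>] by (auto simp: J_def)
  define f where "f n w = Max ((\<lambda>j. \<phi> j (W w)) ` J n)" for n w
  have le_Max: "s j \<le> Max (s ` J n)" if "j \<in> J n" for s :: "_ \<Rightarrow> real" and j n
    using that J(1) by (intro Max_ge) auto
  have Max_eq: "\<exists>j\<in>J n. Max (s ` J n) = s j" for s :: "_ \<Rightarrow> real" and n
  proof -
    have "Max (s ` J n) \<in> s ` J n" using J(1,2) by (intro Max_in) auto
    then show ?thesis by blast
  qed
  have inc: "incseq (\<lambda>n. f n w)" for w
    unfolding f_def incseq_def using J(1,2) by (intro allI impI Max_mono) (auto simp: J_def)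
  have SUP_f: "(SUP n. ereal (f n w)) = (SUP x\<in>A. ereal (F x (\<Sum>i\<in>UNIV. x $ i *\<^sub>R Xs i w)))" for w
  proof -
    have "(SUP n. ereal (f n w)) = (SUP j\<in>I. ereal (\<phi> j (W w)))"
    proof (rule antisym)
      show "(SUP n. ereal (f n w)) \<le> (SUP j\<in>I. ereal (\<phi> j (W w)))"
      proof (rule SUP_least)
        fix n
        obtain j where "j \<in> J n" "f n w = \<phi> j (W w)" using Max_eq unfolding f_def by blast
        then show "ereal (f n w) \<le> (SUP j\<in>I. ereal (\<phi> j (W w)))"
          using J(3)[of n] by (auto intro: SUP_upper)
      qed
      show "(SUP j\<in>I. ereal (\<phi> j (W w))) \<le> (SUP n. ereal (f n w))"
      proof (rule SUP_least)
        fix j assume "j \<in> I"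
        then obtain n where "j = from_nat_into I n"
          using from_nat_into_surj[OF I(2)] by metis
        then have "j \<in> J n" by (auto simp: J_def)
        then have "ereal (\<phi> j (W w)) \<le> ereal (f n w)" 
          unfolding f_def using le_Max[of j n "\<lambda>j. \<phi> j (W w)"] by simp
        then show "ereal (\<phi> j (W w)) \<le> (SUP n. ereal (f n w))" by (rule SUP_upper2[OF UNIV_I])
      qed
    qed
    also have "\<dots> = (SUP x\<in>A. SUP z. ereal (F x z - norm ((\<Sum>i\<in>UNIV. x $ i *\<^sub>R Xs i w) - z)))"
    proof -
      have "A \<times> (UNIV :: (real ^ 'd) set) = (\<Union>x\<in>A. Pair x ` UNIV)" by auto
      then show ?thesis
        unfolding SUP_I by (simp add: SUP_UNION image_image \<phi>_def W_def)
    qed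
    also have "\<dots> = (SUP x\<in>A. ereal (F x (\<Sum>i\<in>UNIV. x $ i *\<^sub>R Xs i w)))"
      by (intro SUP_cong refl SUP_lipschitz_minus_dist assms(10))
    finally show ?thesis .
  qed
  note comparison = Max_comparison[OF J(1,2), where c = "\<lambda>(x, z). F x z" and v = fst and z = snd]
  \<comment> \<open>Expectations of functions of \<open>W\<close> are integrals over
    \<open>gauss_measure\<close>, where the comparison of finite maxima is available.\<close>
  have int_transfer: "integrable M (\<lambda>w. h (W w))" "(\<integral>w. h (W w) \<partial>M) = (\<integral>x. h x \<partial>gauss_measure)"
    if "integrable gauss_measure h" for h :: "_ \<Rightarrow> real"
  proof -
    have [measurable]: "h \<in> borel_measurable borel" using borel_measurable_integrable[OF that] by simp
    show "integrable M (\<lambda>w. h (W w))" "(\<integral>w. h (W w) \<partial>M) = (\<integral>x. h x \<partial>gauss_measure)"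
      using that unfolding W(2)[symmetric] by (simp_all add: integrable_distr_eq integral_distr)
  qed
  have int_\<phi>: "integrable gauss_measure (\<lambda>\<xi>. Max ((\<lambda>j. \<phi> j \<xi>) ` J n))"
    and int_\<psi>: "integrable gauss_measure (\<lambda>\<xi>. Max ((\<lambda>j. \<psi> j \<xi>) ` J n))"
    and \<phi>\<psi>: "(\<integral>\<xi>. Max ((\<lambda>j. \<phi> j \<xi>) ` J n) \<partial>gauss_measure) \<le> (\<integral>\<xi>. Max ((\<lambda>j. \<psi> j \<xi>) ` J n) \<partial>gauss_measure)" for n
    using comparison[of n] by (simp_all add: \<phi>_def \<psi>_def case_prod_beta')
  have "ext_expectation M (\<lambda>w. SUP n. ereal (f n w)) \<le> ?R"
  proof (rule ext_expectation_SUP_le)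
    show "integrable M (f n)" for n
      unfolding f_def by (rule int_transfer[OF int_\<phi>])
    fix n
    have "ereal (\<integral>w. f n w \<partial>M) \<le> ereal (\<integral>w. Max ((\<lambda>j. \<psi> j (W w)) ` J n) \<partial>M)"
      unfolding f_def int_transfer(2)[OF int_\<phi>] int_transfer(2)[OF int_\<psi>] using \<phi>\<psi> by simp
    also have "\<dots> = ext_expectation M (\<lambda>w. ereal (Max ((\<lambda>j. \<psi> j (W w)) ` J n)))"
      by (rule ext_expectation_real[OF int_transfer(1)[OF int_\<psi>], symmetric])
    also have "\<dots> \<le> ?R"
    proof (rule ext_expectation_mono)
      fix w
      \<comment> \<open>The right side takes no countable reduction: the finite maximum is attained
        at one pair \<open>(x, z)\<close>, and its cone lies below \<open>F x\<close>.\<close>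
      obtain j where j: "j \<in> J n" "Max ((\<lambda>j. \<psi> j (W w)) ` J n) = \<psi> j (W w)" using Max_eq by blast
      obtain x z where xz: "j = (x, z)" by (cases j)
      with j J(3) I(1) have x: "x \<in> A" by blast
      have "F x z - norm (norm x *\<^sub>R X w - z) \<le> F x (norm x *\<^sub>R X w)"
        using lipschitz_onD[OF assms(10)[OF x], of z "norm x *\<^sub>R X w"]
        by (simp add: dist_norm norm_minus_commute)
      then have "\<psi> j (W w) \<le> F x (norm x *\<^sub>R X w) + (\<Sum>i\<in>UNIV. x $ i * g i w)"
        by (simp add: \<psi>_def xz W_def inner_vec_def)
      then show "ereal (Max ((\<lambda>j. \<psi> j (W w)) ` J n))
          \<le> (SUP x\<in>A. ereal (F x (norm x *\<^sub>R X w) + (\<Sum>i\<in>UNIV. x $ i * g i w)))"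
        unfolding j(2) using x by (intro SUP_upper2[of x]) simp_all
    qed
    finally show "ereal (\<integral>w. f n w \<partial>M) \<le> ?R" .
  qed (rule inc)
  then show ?thesis unfolding SUP_f .
qed

end
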